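(* Let $\mathbb{W}=m_1P_1+\cdots+m_sP_s$ be a fat point scheme in $\mathbb{P}^n$, and for $i\ge1$ let $\mathbb{W}^{(i)}=(m_1+i)P_1+\cdots+(m_s+i)P_s$ be the $i$-th fattening of $\mathbb{W}$. Then the sequence of graded $R_{\mathbb{W}}$-modules $$0\rightarrow I_{\mathbb{W}^{(1)}}/I_{\mathbb{W}^{(2)}}\stackrel{\alpha}{\rightarrow}I_{\mathbb{W}}\Omega^1_{S/K}/I_{\mathbb{W}^{(1)}}\Omega^1_{S/K}\stackrel{\beta}{\rightarrow}\Omega^2_{S/K}/I_{\mathbb{W}}\Omega^2_{S/K}\stackrel{\gamma}{\rightarrow}\Omega^2_{R_{\mathbb{W}}/K}\rightarrow0$$ is a complex, where $\alpha(F+I_{\mathbb{W}^{(2)}})=dF+I_{\mathbb{W}^{(1)}}\Omega^1_{S/K}$, where $\beta(G\,dX_i+I_{\mathbb{W}^{(1)}}\Omega^1_{S/K})=d(G\,dX_i)+I_{\mathbb{W}}\Omega^2_{S/K}$, and where $\gamma(H+I_{\mathbb{W}}\Omega^2_{S/K})=H+(I_{\mathbb{W}}\Omega^2_{S/K}+dI_{\mathbb{W}}\Omega^1_{S/K})$. Moreover, the following statements hold true. (a) The map $\alpha$ is injective. (b) The map $\gamma$ is surjective. (c) We have $\mathrm{Im}(\beta)=\mathrm{Ker}(\gamma)$. (d) For all $i\ge0$, we have $$\mathrm{HF}_{\Omega^2_{R_{\mathbb{W}}/K}}(i+2)\ge\tfrac{n(n+1)}{2}\mathrm{HF}_{\m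athbb{W}}(i)+\mathrm{HF}_{\mathbb{W}^{(2)}}(i+2)-\mathrm{HF}_{\mathbb{W}^{(1)}}(i+2)-(n+1)\big(\mathrm{HF}_{\mathbb{W}^{(1)}}(i+1)-\mathrm{HF}_{\mathbb{W}}(i+1)\big).$$
   Context: $K$ is a field of characteristic zero, $S=K[X_0,\dots,X_n]$ ($n\ge1$) with the standard grading is the homogeneous coordinate ring of $\mathbb{P}^n$ over $K$. Given distinct $K$-rational points $P_1,\dots,P_s\in\mathbb{P}^n$ ($s\ge1$, coordinates chosen so that none lies on $X_0=0$) with homogeneous vanishing ideals $\wp_1,\dots,\wp_s\subseteq S$ and positive integers $m_1,\dots,m_s$, the fat point scheme $\mathbb{W}=m_1P_1+\cdots+m_sP_s$ is the $0$-dimensional subscheme of $\mathbb{P}^n$ with homogeneous vanishing ideal $I_{\mathbb{W}}=\wp_1^{m_1}\cap\cdots\cap\wp_s^{m_s}$; $R_{\mathbb{W}}=S/I_{\mathbb{W}}$ and $\mathrm{HF}_{\mathbb{W}}$ is the Hilbert function of $R_{\mathbb{W}}$ (similarly for other schemes). $\Omega^1_{S/K}=\bigoplus_{i=0}^n S\,dX_i$ with $\deg(dX_i)=1$, $\Omega^m_{S/K}=\bigwedge^m_S\Omega^1_{S/K}$, and $d:\Omega^m_{S/K}\to\Omega^{m+1}_{S/K}$ is the exterior derivative. $\Omega^1_{R_{\mathbb{W}}/K}$ is the module of Kähler differentials of $R_{\mathbb{W}}/K$ and $\Omega^2_{R_{\mathbb{W}}/K}=\bigwedge^2_{R_{\mathbb{W}}}\Omega^1_{R_{\mathbb{W}}/K}$,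 identified with $\Omega^2_{S/K}/(I_{\mathbb{W}}\Omega^2_{S/K}+dI_{\mathbb{W}}\Omega^1_{S/K})$, where $dI_{\mathbb{W}}\Omega^1_{S/K}$ is the $S$-submodule of $\Omega^2_{S/K}$ generated by all $dF\wedge\omega$ with $F\in I_{\mathbb{W}}$, $\omega\in\Omega^1_{S/K}$. $\mathrm{HF}_M(i)=\dim_K M_i$. *)

theory Defs
  imports
    "Jordan_Normal_Form.Missing_VectorSpace"
    "HOL-Algebra.Algebraic_Closure_Type"
    "HOL-Algebra.QuotRing"
    "HOL-Algebra.Ideal_Product"
    "HOL-Library.Poly_Mapping"
begin

hide_const (open) Multiset.mult Polynomial.smult

section \<open>The graded polynomial ring\<close>

text \<open>
  For \<open>'v\<close> finite and linearly ordered with \<open>n + 1\<close> elements, \<open>('v, 'k) mpoly\<close> is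
  \<open>K[X\<^sub>0, \<dots>, X\<^sub>n]\<close>: the elements of \<open>'v\<close>, in increasing order, are the indices
  \<open>0, \<dots>, n\<close>, monomials are exponent vectors, and a polynomial maps monomials to coefficients.
\<close>

type_synonym ('v, 'k) mpoly = "('v \<Rightarrow>\<^sub>0 nat) \<Rightarrow>\<^sub>0 'k"

abbreviation mpoly_ring :: "('v, 'k::comm_ring_1) mpoly ring" where
  "mpoly_ring \<equiv> ring_of_type_algebra"

definition const_poly :: "'k \<Rightarrow> ('v, 'k::comm_ring_1) mpoly" where
  "const_poly c = Poly_Mapping.single 0 c"

definition mon_degree :: "('v::finite \<Rightarrow>\<^sub>0 nat) \<Rightarrow> nat" where
  "mon_degree e = (\<Sum>i\<in>UNIV. Poly_Mapping.lookup e i)"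

definition eval_at :: "('v::finite \<Rightarrow> 'k) \<Rightarrow> ('v, 'k::comm_ring_1) mpoly \<Rightarrow> 'k" where
  "eval_at a F = (\<Sum>e\<in>Poly_Mapping.keys F.
     Poly_Mapping.lookup F e * (\<Prod>i\<in>UNIV. a i ^ Poly_Mapping.lookup e i))"

definition partial_deriv :: "'v \<Rightarrow> ('v, 'k::comm_ring_1) mpoly \<Rightarrow> ('v, 'k) mpoly" where
  "partial_deriv i F = (\<Sum>e\<in>Poly_Mapping.keys F.
     Poly_Mapping.single (e - Poly_Mapping.single i 1)
       (of_nat (Poly_Mapping.lookup e i) * Poly_Mapping.lookup F e))"

text \<open>
  \<open>homog_shift k d\<close> is the degree \<open>d\<close> part of \<open>S(-k)\<close>, i.e. the homogeneous polynomials of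
  degree \<open>d - k\<close>, which is zero for \<open>d < k\<close>.
\<close>

definition homog_shift :: "nat \<Rightarrow> nat \<Rightarrow> ('v::finite, 'k::comm_ring_1) mpoly set" where
  "homog_shift k d = {F. \<forall>e\<in>Poly_Mapping.keys F. mon_degree e + k = d}"

abbreviation poly_part :: "nat \<Rightarrow> ('v::finite, 'k::comm_ring_1) mpoly set" where
  "poly_part \<equiv> homog_shift 0"


section \<open>Fat point schemes\<close>

text \<open>
  A \<open>K\<close>-rational point of projective space is given by homogeneous coordinates \<open>'v \<Rightarrow> 'k\<close>, not
  all zero; two coordinate vectors give the same point iff they are proportional.
\<close>

definition same_point :: "('v \<Rightarrow> 'k::field) \<Rightarrow> ('v \<Rightarrow> 'k) \<Rightarrow> bool" where
  "same_point a b \<longleftrightarrow> (\<exists>c. c \<noteq> 0 \<and> a = (\<lambda>i. c * b i))"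

definition point_ideal :: "('v::finite \<Rightarrow> 'k::comm_ring_1) \<Rightarrow> ('v, 'k) mpoly set" where
  "point_ideal a = genideal mpoly_ring {F. (\<exists>d. F \<in> poly_part d) \<and> eval_at a F = 0}"

text \<open>The homogeneous vanishing ideal of \<open>m\<^sub>1P\<^sub>1 + \<dots> + m\<^sub>sP\<^sub>s\<close>; \<open>ideals_set\<close> carries the
  multiplicative structure on ideals, so the power is the ideal-theoretic one.\<close>

definition fat_ideal ::
    "nat \<Rightarrow> (nat \<Rightarrow> 'v::finite \<Rightarrow> 'k::comm_ring_1) \<Rightarrow> (nat \<Rightarrow> nat) \<Rightarrow> ('v, 'k) mpoly set" where
  "fat_ideal s P m = (\<Inter>j\<in>{1..s}. point_ideal (P j) [^]\<^bsub>ideals_set mpoly_ring\<^esub> m j)"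

definition fattening :: "(nat \<Rightarrow> nat) \<Rightarrow> nat \<Rightarrow> nat \<Rightarrow> nat" where
  "fattening m i = (\<lambda>j. m j + i)"


section \<open>Differential forms on the polynomial ring\<close>

text \<open>
  The 1-form \<open>\<Sum>\<^sub>i F\<^sub>i dX\<^sub>i\<close> is the function \<open>i \<mapsto> F\<^sub>i\<close>.  The 2-form
  \<open>\<Sum>\<^sub>i\<^sub><\<^sub>j F\<^sub>i\<^sub>j dX\<^sub>i \<and> dX\<^sub>j\<close> is the function \<open>(i, j) \<mapsto> F\<^sub>i\<^sub>j\<close> that is zero
  unless \<open>i < j\<close>.  The ring operations \<open>mult\<close> and \<open>one\<close> of a module record play no role.
\<close>

type_synonym ('v, 'k) form1 = "'v \<Rightarrow> ('v, 'k) mpoly"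
type_synonym ('v, 'k) form2 = "'v \<times> 'v \<Rightarrow> ('v, 'k) mpoly"

definition Omega1 :: "(('v, 'k::comm_ring_1) mpoly, ('v, 'k) form1) module" where
  "Omega1 = \<lparr>carrier = UNIV, mult = undefined, one = undefined, zero = (\<lambda>_. 0),
     add = (\<lambda>\<omega> \<eta> i. \<omega> i + \<eta> i), smult = (\<lambda>F \<omega> i. F * \<omega> i)\<rparr>"

definition Omega2 :: "(('v::linorder, 'k::comm_ring_1) mpoly, ('v, 'k) form2) module" where
  "Omega2 = \<lparr>carrier = {w. \<forall>i j. \<not> i < j \<longrightarrow> w (i, j) = 0},
     mult = undefined, one = undefined, zero = (\<lambda>_. 0),
     add = (\<lambda>v w p. v p + w p), smult = (\<lambda>F w p. F * w p)\<rparr>"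

definition form1_part :: "nat \<Rightarrow> ('v::finite, 'k::comm_ring_1) form1 set" where
  "form1_part d = {\<omega>. \<forall>i. \<omega> i \<in> homog_shift 1 d}"

definition form2_part :: "nat \<Rightarrow> ('v::{finite,linorder}, 'k::comm_ring_1) form2 set" where
  "form2_part d = {w \<in> carrier Omega2. \<forall>p. w p \<in> homog_shift 2 d}"

definition dX :: "'v \<Rightarrow> ('v, 'k::comm_ring_1) form1" where
  "dX i = (\<lambda>j. if j = i then 1 else 0)"

definition wedge ::
    "('v::linorder, 'k::comm_ring_1) form1 \<Rightarrow> ('v, 'k) form1 \<Rightarrow> ('v, 'k) form2" where
  "wedge \<omega> \<eta> = (\<lambda>(i, j). if i < j then \<omega> i * \<eta> j - \<omega> j * \<eta> i else 0)"

definition d0 :: "('v, 'k::comm_ring_1) mpoly \<Rightarrow> ('v, 'k) form1" where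
  "d0 F = (\<lambda>i. partial_deriv i F)"

text \<open>\<open>d(\<Sum>\<^sub>i F\<^sub>i dX\<^sub>i) = \<Sum>\<^sub>i dF\<^sub>i \<and> dX\<^sub>i\<close>\<close>

definition d1 :: "('v::{finite,linorder}, 'k::comm_ring_1) form1 \<Rightarrow> ('v, 'k) form2" where
  "d1 \<omega> = (\<lambda>p. \<Sum>i\<in>UNIV. wedge (d0 (\<omega> i)) (dX i) p)"


section \<open>Graded modules and their Hilbert functions\<close>

definition regular_module :: "'a ring \<Rightarrow> ('a, 'a) module" where
  "regular_module R = ring.extend R (module.fields (mult R))"

definition ideal_times :: "'a ring \<Rightarrow> ('a, 'b) module \<Rightarrow> 'a set \<Rightarrow> 'b set" where
  "ideal_times R M I = LinearCombinations.module.span R M {a \<odot>\<^bsub>M\<^esub> x | a x. a \<in> I \<and> x \<in> carrier M}"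

text \<open>
  The subquotient \<open>U/N\<close> of an \<open>R\<close>-module \<open>M\<close>, with its scalar multiplication by elements of a
  quotient ring \<open>R Quot I\<close>, following \<^const>\<open>FactRing\<close> and \<^const>\<open>rcoset_mult\<close>.
  The ideal \<open>I\<close> enters only through the cosets used as scalars; the multiplication is
  well-defined iff \<open>I\<close> annihilates \<open>U/N\<close>.
\<close>

definition subquotient ::
    "('a, 'b) module \<Rightarrow> 'b set \<Rightarrow> 'b set \<Rightarrow> ('a set, 'b set) module" where
  "subquotient M U N = \<lparr>carrier = {N +>\<^bsub>M\<^esub> x | x. x \<in> U}, mult = undefined, one = undefined,
     zero = N, add = set_add M,
     smult = (\<lambda>A B. \<Union>a\<in>A. \<Union>x\<in>B. N +>\<^bsub>M\<^esub> (a \<odot>\<^bsub>M\<^esub> x))\<rparr>"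

definition subquotient_part ::
    "('a, 'b) module \<Rightarrow> (nat \<Rightarrow> 'b set) \<Rightarrow> 'b set \<Rightarrow> 'b set \<Rightarrow> nat \<Rightarrow> 'b set set" where
  "subquotient_part M G U N d = {N +>\<^bsub>M\<^esub> x | x. x \<in> U \<inter> G d}"

definition is_grading :: "('b, 'c) ring_scheme \<Rightarrow> (nat \<Rightarrow> 'b set) \<Rightarrow> bool" where
  "is_grading M G \<longleftrightarrow>
     (\<forall>d. subgroup (G d) (add_monoid M)) \<and>
     (\<forall>x\<in>carrier M. \<exists>!f. (\<forall>d. f d \<in> G d) \<and> finite {d. f d \<noteq> \<zero>\<^bsub>M\<^esub>} \<and>
        x = finsum M f {d. f d \<noteq> \<zero>\<^bsub>M\<^esub>})"

definition graded_ring :: "'a ring \<Rightarrow> (nat \<Rightarrow> 'a set) \<Rightarrow> bool" where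
  "graded_ring R RG \<longleftrightarrow> cring R \<and> is_grading R RG \<and> \<one>\<^bsub>R\<^esub> \<in> RG 0 \<and>
     (\<forall>a b. \<forall>r\<in>RG a. \<forall>t\<in>RG b. r \<otimes>\<^bsub>R\<^esub> t \<in> RG (a + b))"

definition graded_module ::
    "'a ring \<Rightarrow> (nat \<Rightarrow> 'a set) \<Rightarrow> ('a, 'b) module \<Rightarrow> (nat \<Rightarrow> 'b set) \<Rightarrow> bool" where
  "graded_module R RG M G \<longleftrightarrow> graded_ring R RG \<and> Module.module R M \<and> is_grading M G \<and>
     (\<forall>a b. \<forall>r\<in>RG a. \<forall>x\<in>G b. r \<odot>\<^bsub>M\<^esub> x \<in> G (a + b))"

definition graded_hom ::
    "'a ring \<Rightarrow> ('a, 'b) module \<Rightarrow> (nat \<Rightarrow> 'b set) \<Rightarrow> ('a, 'c) module \<Rightarrow> (nat \<Rightarrow> 'c set) \<Rightarrow>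
     ('b \<Rightarrow> 'c) \<Rightarrow> bool" where
  "graded_hom R M G N H f \<longleftrightarrow>
     f \<in> LinearCombinations.module_hom R M N \<and> (\<forall>d. f ` G d \<subseteq> H d)"

text \<open>
  \<open>HF\<^sub>M(d) = dim\<^sub>K M\<^sub>d\<close> for a module \<open>M\<close> over \<open>S/I\<close> with graded parts \<open>G\<close>; the field \<open>K\<close> acts
  through \<open>K \<rightarrow> S \<rightarrow> S/I\<close>.
\<close>

definition hilbert_function ::
    "('v, 'k::field) mpoly set \<Rightarrow> (('v, 'k) mpoly set, 'b) module \<Rightarrow> (nat \<Rightarrow> 'b set) \<Rightarrow> nat \<Rightarrow> nat"
  where
  "hilbert_function I M G d = vectorspace.dim (ring_of_type_algebra :: 'k ring)
     \<lparr>carrier = G d, mult = undefined, one = undefined, zero = \<zero>\<^bsub>M\<^esub>, add = add M,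
      smult = (\<lambda>c x. (I +>\<^bsub>mpoly_ring\<^esub> const_poly c) \<odot>\<^bsub>M\<^esub> x)\<rparr>"


section \<open>The coordinate ring of a scheme and its Kaehler 2-forms\<close>

abbreviation coord_ring :: "('v, 'k::comm_ring_1) mpoly set \<Rightarrow> ('v, 'k) mpoly set ring" where
  "coord_ring I \<equiv> mpoly_ring Quot I"

definition coord_ring_part ::
    "('v::finite, 'k::comm_ring_1) mpoly set \<Rightarrow> nat \<Rightarrow> ('v, 'k) mpoly set set" where
  "coord_ring_part I d = {I +>\<^bsub>mpoly_ring\<^esub> F | F. F \<in> poly_part d}"

definition HF_scheme :: "('v::finite, 'k::field) mpoly set \<Rightarrow> nat \<Rightarrow> nat" where
  "HF_scheme I = hilbert_function I (regular_module (coord_ring I)) (coord_ring_part I)"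

text \<open>The submodule \<open>I \<Omega>\<^sup>2 + dI \<Omega>\<^sup>1\<close> of \<open>\<Omega>\<^sup>2\<close>, whose quotient is \<open>\<Omega>\<^sup>2\<close> of \<open>S/I\<close>.\<close>

definition kaehler2_relations ::
    "('v::{finite,linorder}, 'k::comm_ring_1) mpoly set \<Rightarrow> ('v, 'k) form2 set" where
  "kaehler2_relations I = ideal_times mpoly_ring Omega2 I <+>\<^bsub>Omega2\<^esub>
     LinearCombinations.module.span mpoly_ring Omega2 {wedge (d0 F) \<omega> | F \<omega>. F \<in> I \<and> \<omega> \<in> carrier Omega1}"

definition Kaehler2 ::
    "('v::{finite,linorder}, 'k::comm_ring_1) mpoly set \<Rightarrow> (('v, 'k) mpoly set, ('v, 'k) form2 set) module"
  where
  "Kaehler2 I = subquotient Omega2 (carrier Omega2) (kaehler2_relations I)"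

definition Kaehler2_part ::
    "('v::{finite,linorder}, 'k::comm_ring_1) mpoly set \<Rightarrow> nat \<Rightarrow> ('v, 'k) form2 set set" where
  "Kaehler2_part I = subquotient_part Omega2 form2_part (carrier Omega2) (kaehler2_relations I)"

end

theory Submission
  imports Defs "HOL-Library.Function_Algebras"
begin

text \<open>
  A derivation maps \<open>\<wp>\<^sup>k\<^sup>+\<^sup>1\<close> to \<open>\<wp>\<^sup>k\<close>, which makes the maps well defined.  For the
  injectivity of \<open>\<alpha>\<close>, let \<open>\<wp>\<close> be generated by the linear forms \<open>Y\<^sub>i = X\<^sub>i - (a\<^sub>i/a\<^sub>0) X\<^sub>0\<close>.  The
  derivation \<open>E = \<Sum>\<^sub>i Y\<^sub>i \<partial>/\<partial>X\<^sub>i\<close> fixes each \<open>Y\<^sub>i\<close> and hence acts on \<open>\<wp>\<^sup>k/\<wp>\<^sup>k\<^sup>+\<^sup>1\<close> as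
  multiplication by \<open>k\<close>.  If \<open>F \<in> \<wp>\<^sup>k\<close> has all its partial derivatives in \<open>\<wp>\<^sup>k\<close>, then
  \<open>E F \<in> \<wp>\<^sup>k\<^sup>+\<^sup>1\<close>, so that \<open>k F \<in> \<wp>\<^sup>k\<^sup>+\<^sup>1\<close>, and in characteristic zero \<open>F \<in> \<wp>\<^sup>k\<^sup>+\<^sup>1\<close>.

  Exactness at \<open>\<Omega>\<^sup>2/I \<Omega>\<^sup>2\<close> comes from \<open>dF \<and> \<omega> = d(F \<omega>) - F d\<omega>\<close>.  The inequality is
  rank-nullity along the degree \<open>i + 2\<close> strand of the complex.
\<close>

section \<open>Homogeneous components and partial derivatives\<close>

text \<open>The exterior derivative is not S-linear, and this dictates the quotients in the
  sequence: d(rF) - r dF = F dr and d(r \<omega>) - r d\<omega> = dr \<and> \<omega>, and these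
  defects vanish modulo \<open>I1\<close> Omega^1 for F in \<open>I1\<close> and modulo
  \<open>I0\<close> Omega^2 for \<omega> in \<open>I0\<close> Omega^1. The two left quotients are
  modules over S/\<open>I0\<close> because \<open>I0 * I0\<close> lies in \<open>I1\<close> and
  \<open>I0 * I1\<close> lies in \<open>I2\<close>; comparing exponents, both come down to m_j >= 1.
  The Euler argument is applied with k = m_j + 1. Exactness at the second term is not claimed: the
  image of \<alpha> is only contained in the kernel of \<beta>. The dimension of the homology there,
  in degree i + 2, is exactly the gap in the inequality. The factors n + 1 and n(n+1)/2 are the
  ranks of Omega^1 and Omega^2. Four graded quotients over the same ring, with three different
  ambient modules, have to be built and measured. They are therefore all treated as subquotients of
  a module whose grading is given by projections.\<close>

lemma mon_degree_add: "mon_degree (e + f) = mon_degree e + mon_degree f"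
  by (simp add: mon_degree_def lookup_add sum.distrib)

lemma mon_degree_single: "mon_degree (Poly_Mapping.single i n) = n"
  by (simp add: mon_degree_def lookup_single when_def)

lemma mon_degree_zero: "mon_degree 0 = 0"
  by (simp add: mon_degree_def)

lemma sum_singles:
  fixes F :: "'a \<Rightarrow>\<^sub>0 'b::comm_monoid_add"
  shows "F = (\<Sum>e\<in>Poly_Mapping.keys F. Poly_Mapping.single e (Poly_Mapping.lookup F e))"
  by (rule poly_mapping_eqI)
    (simp add: lookup_sum lookup_single when_def not_in_keys_iff_lookup_eq_zero)

lemma mpoly_induct [case_names single add]:
  fixes F :: "'a \<Rightarrow>\<^sub>0 'b::comm_monoid_add"
  assumes "\<And>e c. P (Poly_Mapping.single e c)" and "\<And>F G. P F \<Longrightarrow> P G \<Longrightarrow> P (F + G)"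
  shows "P F"
proof -
  \<comment> \<open>The zero polynomial is itself a monomial with coefficient 0, which settles the
    empty sum without a separate assumption.\<close>
  have "P (\<Sum>e\<in>A. Poly_Mapping.single e (Poly_Mapping.lookup F e))" for A
    by (induction A rule: infinite_finite_induct) (use assms(1)[of undefined 0] in \<open>auto intro: assms\<close>)
  then show ?thesis
    by (subst sum_singles)
qed

text \<open>The projection of S(-k) onto its degree d part. The shift makes one operator serve
  polynomials (k = 0), 1-forms (k = 1) and 2-forms (k = 2). Homogeneity becomes a fixed-point
  equation, which the simplifier can use.\<close>

definition hcomp :: "nat \<Rightarrow> nat \<Rightarrow> ('v::finite, 'k::comm_ring_1) mpoly \<Rightarrow> ('v, 'k) mpoly" where
  "hcomp k d F = Poly_Mapping.mapp (\<lambda>e c. c when mon_degree e + k = d) F"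

lemma lookup_hcomp:
  "Poly_Mapping.lookup (hcomp k d F) e = (Poly_Mapping.lookup F e when mon_degree e + k = d)"
  by (auto simp: hcomp_def lookup_mapp when_def not_in_keys_iff_lookup_eq_zero)

lemma homog_shift_iff: "F \<in> homog_shift k d \<longleftrightarrow> hcomp k d F = F"
  by (auto simp: homog_shift_def poly_mapping_eq_iff fun_eq_iff lookup_hcomp when_def in_keys_iff)

lemma hcomp_zero [simp]: "hcomp k d 0 = 0"
  by (rule poly_mapping_eqI) (simp add: lookup_hcomp)

lemma hcomp_add: "hcomp k d (F + G) = hcomp k d F + hcomp k d G"
  by (rule poly_mapping_eqI) (simp add: lookup_hcomp lookup_add when_def)

lemma hcomp_diff: "hcomp k d (F - G) = hcomp k d F - hcomp k d G"
  by (rule poly_mapping_eqI) (simp add: lookup_hcomp lookup_minus when_def)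

lemma hcomp_sum: "hcomp k d (\<Sum>x\<in>A. F x) = (\<Sum>x\<in>A. hcomp k d (F x))"
  by (induction A rule: infinite_finite_induct) (simp_all add: hcomp_add)

lemma hcomp_hcomp: "hcomp k d (hcomp k e F) = (if d = e then hcomp k e F else 0)"
  by (rule poly_mapping_eqI) (simp add: lookup_hcomp when_def)

lemma hcomp_in_homog_shift: "hcomp k d F \<in> homog_shift k d"
  by (simp add: homog_shift_iff hcomp_hcomp)

lemma finite_hcomp_support: "finite {d. hcomp k d F \<noteq> 0}"
proof (rule finite_subset)
  show "{d. hcomp k d F \<noteq> 0} \<subseteq> (\<lambda>e. mon_degree e + k) ` Poly_Mapping.keys F"
  proof clarify
    fix d assume "hcomp k d F \<noteq> 0"
    then obtain e where "Poly_Mapping.lookup (hcomp k d F) e \<noteq> 0"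
      by (metis lookup_zero poly_mapping_eqI)
    then show "d \<in> (\<lambda>e. mon_degree e + k) ` Poly_Mapping.keys F"
      by (auto simp: lookup_hcomp when_def in_keys_iff split: if_splits)
  qed
qed simp

lemma sum_hcomp:
  assumes "finite D" and "{d. hcomp k d F \<noteq> 0} \<subseteq> D"
  shows "(\<Sum>d\<in>D. hcomp k d F) = F"
proof (rule poly_mapping_eqI)
  fix e
  have "Poly_Mapping.lookup F e = 0" if "mon_degree e + k \<notin> D"
  proof -
    from that assms(2) have "hcomp k (mon_degree e + k) F = 0"
      by auto
    then have "Poly_Mapping.lookup (hcomp k (mon_degree e + k) F) e = 0"
      by simp
    then show ?thesis
      by (simp add: lookup_hcomp)
  qed
  with assms(1) show "Poly_Mapping.lookup (\<Sum>d\<in>D. hcomp k d F) e = Poly_Mapping.lookup F e"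
    by (auto simp: lookup_sum lookup_hcomp when_def)
qed

lemma homog_shift_mult:
  assumes "F \<in> poly_part a" and "G \<in> homog_shift k b"
  shows "F * G \<in> homog_shift k (a + b)"
  unfolding homog_shift_def
proof (clarify)
  fix e assume "e \<in> Poly_Mapping.keys (F * G)"
  then obtain f g where "e = f + g" "f \<in> Poly_Mapping.keys F" "g \<in> Poly_Mapping.keys G"
    using keys_mult[of F G] by blast
  with assms show "mon_degree e + k = a + b"
    by (auto simp: homog_shift_def mon_degree_add)
qed

section \<open>Partial derivatives, coefficient by coefficient\<close>

lemma lookup_partial_deriv:
  "Poly_Mapping.lookup (partial_deriv i F) e =
    of_nat (Poly_Mapping.lookup e i + 1) * Poly_Mapping.lookup F (e + Poly_Mapping.single i 1)"
proof -
  have "(of_nat (Poly_Mapping.lookup f i) * Poly_Mapping.lookup F f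
          when f - Poly_Mapping.single i 1 = e) =
        (of_nat (Poly_Mapping.lookup e i + 1) * Poly_Mapping.lookup F f
          when f = e + Poly_Mapping.single i 1)" for f
  \<comment> \<open>Subtraction of exponents is truncated: a monomial free of the variable
    \<open>i\<close> is left unchanged by it, but then its coefficient carries the factor 0.\<close>
  proof (cases "Poly_Mapping.lookup f i = 0")
    case True
    then show ?thesis
      by (auto simp: when_def lookup_add)
  next
    case False
    then have "(f - Poly_Mapping.single i 1) + Poly_Mapping.single i 1 = f"
      by (intro poly_mapping_eqI) (auto simp: lookup_add lookup_minus lookup_single when_def)
    then have "f - Poly_Mapping.single i 1 = e \<longleftrightarrow> f = e + Poly_Mapping.single i 1"
      by auto
    then show ?thesis
      by (auto simp: when_def lookup_add)
  qed
  then have "Poly_Mapping.lookup (partial_deriv i F) e =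
     (\<Sum>f\<in>Poly_Mapping.keys F. of_nat (Poly_Mapping.lookup e i + 1) * Poly_Mapping.lookup F f
          when f = e + Poly_Mapping.single i 1)"
    by (simp add: partial_deriv_def lookup_sum lookup_single)
  also have "\<dots> = of_nat (Poly_Mapping.lookup e i + 1) * Poly_Mapping.lookup F (e + Poly_Mapping.single i 1)"
    by (auto simp: when_def not_in_keys_iff_lookup_eq_zero)
  finally show ?thesis .
qed

lemma partial_deriv_add: "partial_deriv i (F + G) = partial_deriv i F + partial_deriv i G"
  by (rule poly_mapping_eqI) (simp add: lookup_partial_deriv lookup_add algebra_simps)

lemma partial_deriv_diff: "partial_deriv i (F - G) = partial_deriv i F - partial_deriv i G"
  by (rule poly_mapping_eqI) (simp add: lookup_partial_deriv lookup_minus algebra_simps)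

lemma partial_deriv_single:
  "partial_deriv i (Poly_Mapping.single e c) =
    Poly_Mapping.single (e - Poly_Mapping.single i 1) (of_nat (Poly_Mapping.lookup e i) * c)"
  by (auto simp: partial_deriv_def)

text \<open>Both sides are biadditive, so the Leibniz rule is needed for two monomials only.\<close>

lemma partial_deriv_mult:
  "partial_deriv i (F * G) = partial_deriv i F * G + F * partial_deriv i G"
proof (induction F rule: mpoly_induct)
  case (single e c)
  show ?case
  proof (induction G rule: mpoly_induct)
    case (single f d)
    \<comment> \<open>Truncated subtraction commutes with adding \<open>f'\<close> only if
      \<open>i\<close> occurs in \<open>e'\<close>; otherwise both sides are monomials with
      coefficient 0.\<close>
    have shift: "Poly_Mapping.single (e' - Poly_Mapping.single i 1 + f')
          (of_nat (Poly_Mapping.lookup e' i) * b) =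
        Poly_Mapping.single (e' + f' - Poly_Mapping.single i 1) (of_nat (Poly_Mapping.lookup e' i) * b)"
      for e' f' and b :: 'b
    proof (cases "Poly_Mapping.lookup e' i = 0")
      case False
      then have "e' - Poly_Mapping.single i 1 + f' = e' + f' - Poly_Mapping.single i 1"
        by (intro poly_mapping_eqI) (auto simp: lookup_add lookup_minus lookup_single when_def)
      then show ?thesis by simp
    qed simp
    from shift[of e f "c * d"] shift[of f e "c * d"] show ?case
      by (simp add: mult_single partial_deriv_single lookup_add algebra_simps flip: single_add)
  next
    case (add F G)
    then show ?case
      by (simp add: algebra_simps partial_deriv_add)
  qed
next
  case (add F G)
  then show ?case
    by (simp add: algebra_simps partial_deriv_add)
qed

lemma partial_deriv_commute:
  "partial_deriv i (partial_deriv j F) = partial_deriv j (partial_deriv i F)"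
  by (rule poly_mapping_eqI)
    (auto simp: lookup_partial_deriv lookup_add lookup_single when_def add_ac mult_ac)

text \<open>A derivative loses one polynomial degree and the accompanying \<open>dX\<close> restores
  it. In the shifted convention the index \<open>d\<close> stays fixed, so no degree is ever
  subtracted; this is why \<open>d0\<close> and \<open>d1\<close> preserve degrees.\<close>

lemma hcomp_partial_deriv: "hcomp (Suc k) d (partial_deriv i F) = partial_deriv i (hcomp k d F)"
  by (rule poly_mapping_eqI)
    (auto simp: lookup_partial_deriv lookup_hcomp mon_degree_add mon_degree_single when_def)

lemma partial_deriv_zero [simp]: "partial_deriv i 0 = 0"
  by (simp add: partial_deriv_def)

lemma const_poly_in_poly_part: "const_poly c \<in> poly_part 0"
  by (auto simp: const_poly_def homog_shift_def mon_degree_zero)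

lemma const_poly_add: "const_poly (c + c') = const_poly c + const_poly c'"
  by (simp add: const_poly_def single_add)

lemma const_poly_mult: "const_poly (c * c') = const_poly c * const_poly c'"
  by (simp add: const_poly_def mult_single)

lemma const_poly_one: "const_poly 1 = 1"
  by (simp add: const_poly_def)


section \<open>Homogeneous ideals\<close>

lemma carrier_mpoly_ring [simp]: "carrier (ring_of_type_algebra :: 'a::comm_ring_1 ring) = UNIV"
  and mult_mpoly_ring [simp]: "x \<otimes>\<^bsub>(ring_of_type_algebra :: 'a ring)\<^esub> y = x * y"
  and add_mpoly_ring [simp]: "x \<oplus>\<^bsub>(ring_of_type_algebra :: 'a ring)\<^esub> y = x + y"
  and zero_mpoly_ring [simp]: "\<zero>\<^bsub>(ring_of_type_algebra :: 'a ring)\<^esub> = 0"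
  and one_mpoly_ring [simp]: "\<one>\<^bsub>(ring_of_type_algebra :: 'a ring)\<^esub> = 1"
  by (simp_all add: ring_of_type_algebra_def)

text \<open>Negation is multiplication by \<open>- 1\<close>, so three elementwise closure
  conditions suffice, and ideals can be handled without the ring record.\<close>

lemma ideal_iff:
  fixes I :: "'a::comm_ring_1 set"
  shows "ideal I ring_of_type_algebra \<longleftrightarrow>
    0 \<in> I \<and> (\<forall>x\<in>I. \<forall>y\<in>I. x + y \<in> I) \<and> (\<forall>r. \<forall>x\<in>I. r * x \<in> I)"
proof
  assume "ideal I ring_of_type_algebra"
  then interpret ideal I "ring_of_type_algebra :: 'a ring" .
  show "0 \<in> I \<and> (\<forall>x\<in>I. \<forall>y\<in>I. x + y \<in> I) \<and> (\<forall>r. \<forall>x\<in>I. r * x \<in> I)"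
    using additive_subgroup.zero_closed[OF additive_subgroup_axioms]
      additive_subgroup.a_closed[OF additive_subgroup_axioms] I_l_closed by auto
next
  assume I: "0 \<in> I \<and> (\<forall>x\<in>I. \<forall>y\<in>I. x + y \<in> I) \<and> (\<forall>r. \<forall>x\<in>I. r * x \<in> I)"
  interpret cring "ring_of_type_algebra :: 'a ring"
    by (rule cring_from_type_algebra)
  have inv: "inv\<^bsub>add_monoid (ring_of_type_algebra :: 'a ring)\<^esub> x = - x" for x :: 'a
    using minus_equality[of "- x" x] by (simp add: a_inv_def)
  have "- x \<in> I" if "x \<in> I" for x
    using I that by (metis mult_minus1)
  then have "inv\<^bsub>add_monoid (ring_of_type_algebra :: 'a ring)\<^esub> x \<in> I" if "x \<in> I" for x
    unfolding inv using that .
  with I have "subgroup I (add_monoid ring_of_type_algebra)"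
    by (intro subgroup.intro) (simp_all del: carrier_mpoly_ring add: ring_of_type_algebra_def)
  moreover have "a * r \<in> I" if "a \<in> I" for a r
    using I that by (metis mult.commute)
  ultimately show "ideal I ring_of_type_algebra"
    using I ring_axioms by (intro idealI) auto
qed

lemma ideal_mult_left: "ideal I ring_of_type_algebra \<Longrightarrow> x \<in> I \<Longrightarrow> r * x \<in> I"
  and ideal_mult_right: "ideal I ring_of_type_algebra \<Longrightarrow> x \<in> I \<Longrightarrow> x * r \<in> I"
  and ideal_add: "ideal I ring_of_type_algebra \<Longrightarrow> x \<in> I \<Longrightarrow> y \<in> I \<Longrightarrow> x + y \<in> I"
  and ideal_zero: "ideal I ring_of_type_algebra \<Longrightarrow> 0 \<in> I"
  for I :: "'a::comm_ring_1 set"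
  by (simp_all add: ideal_iff mult.commute[of x r])

lemma ideal_uminus: "ideal I ring_of_type_algebra \<Longrightarrow> x \<in> I \<Longrightarrow> - x \<in> I"
  for I :: "'a::comm_ring_1 set"
  by (metis ideal_iff mult_minus1)

lemma ideal_diff: "ideal I ring_of_type_algebra \<Longrightarrow> x \<in> I \<Longrightarrow> y \<in> I \<Longrightarrow> x - y \<in> I"
  for I :: "'a::comm_ring_1 set"
  by (metis ideal_iff ideal_uminus uminus_add_conv_diff add.commute)

lemma ideal_sum: "ideal I ring_of_type_algebra \<Longrightarrow> (\<And>a. a \<in> A \<Longrightarrow> f a \<in> I) \<Longrightarrow> (\<Sum>a\<in>A. f a) \<in> I"
  for I :: "'a::comm_ring_1 set"
  by (induction A rule: infinite_finite_induct) (auto simp: ideal_iff)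

text \<open>Homogeneity as stability under projections, not as existence of homogeneous generators:
  it passes to intersections at once, and it is the condition under which the quotient inherits the
  grading.\<close>

definition homog_ideal :: "('v::finite, 'k::comm_ring_1) mpoly set \<Rightarrow> bool" where
  "homog_ideal I \<longleftrightarrow> ideal I mpoly_ring \<and> (\<forall>d. \<forall>F\<in>I. hcomp 0 d F \<in> I)"

text \<open>Expanding both factors into components, only pairs of degrees with sum \<open>d\<close>
  survive. Membership of a component of a product is thereby reduced to products of
  components.\<close>

lemma hcomp_mult:
  "hcomp k d (F * G) = (\<Sum>a\<in>{..d}. hcomp 0 a F * hcomp k (d - a) G)"
proof -
  \<comment> \<open>The index sets contain the supports, to recover \<open>F\<close> and
    \<open>G\<close>, and also \<open>{..d}\<close>, so that the final sum has its uniform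
    range.\<close>
  define D where "D = {a. hcomp 0 a F \<noteq> 0} \<union> {..d}"
  define D' where "D' = {a. hcomp k a G \<noteq> 0} \<union> {..d}"
  have fin: "finite D" "finite D'"
    by (auto simp: D_def D'_def finite_hcomp_support)
  have "F * G = (\<Sum>a\<in>D. hcomp 0 a F) * (\<Sum>b\<in>D'. hcomp k b G)"
    by (subst (1 2) sum_hcomp) (use fin in \<open>auto simp: D_def D'_def\<close>)
  also have "\<dots> = (\<Sum>a\<in>D. \<Sum>b\<in>D'. hcomp 0 a F * hcomp k b G)"
    by (simp add: sum_product)
  finally have "hcomp k d (F * G) = (\<Sum>a\<in>D. \<Sum>b\<in>D'. hcomp k d (hcomp 0 a F * hcomp k b G))"
    by (simp add: hcomp_sum)
  also have "\<dots> = (\<Sum>a\<in>D. \<Sum>b\<in>D'. if d = a + b then hcomp 0 a F * hcomp k b G else 0)"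
  proof (intro sum.cong refl)
    show "hcomp k d (hcomp 0 a F * hcomp k b G) =
      (if d = a + b then hcomp 0 a F * hcomp k b G else 0)" for a b
      using homog_shift_mult[OF hcomp_in_homog_shift[of 0 a F] hcomp_in_homog_shift[of k b G]]
        hcomp_hcomp[of k d "a + b" "hcomp 0 a F * hcomp k b G"]
      by (auto simp: homog_shift_iff)
  qed
  also have "(\<Sum>a\<in>D. \<Sum>b\<in>D'. if d = a + b then hcomp 0 a F * hcomp k b G else 0) =
      (\<Sum>a\<in>D. if a \<le> d then hcomp 0 a F * hcomp k (d - a) G else 0)"
  proof (rule sum.cong[OF refl])
    fix a
    have "(\<Sum>b\<in>D'. if d = a + b then hcomp 0 a F * hcomp k b G else 0) =
        (\<Sum>b\<in>D'. if b = d - a then (if a \<le> d then hcomp 0 a F * hcomp k b G else 0) else 0)"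
      by (rule sum.cong) auto
    then show "(\<Sum>b\<in>D'. if d = a + b then hcomp 0 a F * hcomp k b G else 0) =
        (if a \<le> d then hcomp 0 a F * hcomp k (d - a) G else 0)"
      using fin(2) by (auto simp: D'_def)
  qed
  also have "\<dots> = (\<Sum>a\<in>{..d}. hcomp 0 a F * hcomp k (d - a) G)"
    using fin(1) by (auto simp: sum.If_cases D_def intro!: sum.cong)
  finally show ?thesis .
qed

text \<open>The elements of the generated ideal whose components all stay in it form an ideal
  containing the generators, hence by minimality the whole of it.\<close>

lemma homog_ideal_genideal:
  assumes "A \<subseteq> (\<Union>d. poly_part d)"
  shows "homog_ideal (genideal mpoly_ring A)"
proof -
  interpret cring "mpoly_ring :: ('a, 'b) mpoly ring"
    by (rule cring_from_type_algebra)
  define J where "J = genideal mpoly_ring A"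
  have J: "ideal J mpoly_ring"
    by (auto simp: J_def intro: genideal_ideal)
  define T where "T = {F\<in>J. \<forall>d. hcomp 0 d F \<in> J}"
  have "ideal T mpoly_ring"
    unfolding ideal_iff T_def using J
    by (auto simp: hcomp_add hcomp_mult ideal_iff intro!: ideal_sum[OF J])
  moreover have "A \<subseteq> T"
  proof
    fix F assume "F \<in> A"
    then have "F \<in> J"
      using genideal_self[of A] by (auto simp: J_def)
    from \<open>F \<in> A\<close> assms obtain d where "hcomp 0 d F = F"
      by (auto simp: homog_shift_iff)
    then have "hcomp 0 e F = (if e = d then F else 0)" for e
      by (metis hcomp_hcomp)
    with \<open>F \<in> J\<close> J show "F \<in> T"
      by (simp add: T_def ideal_iff)
  qed
  ultimately have "J \<subseteq> T"
    unfolding J_def by (rule genideal_minimal)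
  with J show ?thesis
    by (auto simp: homog_ideal_def T_def J_def)
qed

section \<open>Powers of an ideal\<close>

definition ideal_power :: "('v::finite, 'k::comm_ring_1) mpoly set \<Rightarrow> nat \<Rightarrow> ('v, 'k) mpoly set" where
  "ideal_power J k = J [^]\<^bsub>ideals_set mpoly_ring\<^esub> k"

lemma ideal_power_0: "ideal_power J 0 = UNIV"
  and ideal_power_Suc: "ideal_power J (Suc k) = ideal_prod mpoly_ring (ideal_power J k) J"
  by (simp_all add: ideal_power_def nat_pow_def ideals_set_def)

lemma ideal_ideal_power: "ideal J mpoly_ring \<Longrightarrow> ideal (ideal_power J k) mpoly_ring"
proof (induction k)
  case 0
  show ?case by (simp add: ideal_power_0 ideal_iff)
next
  case (Suc k)
  then show ?case
    unfolding ideal_power_Suc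
    by (intro ring.ideal_prod_is_ideal ring_from_type_algebra) auto
qed

text \<open>An ideal product consists of sums of products F G, and the components of F G are sums of
  products of components of the factors.\<close>

lemma homog_ideal_power: "homog_ideal J \<Longrightarrow> homog_ideal (ideal_power J k)"
proof (induction k)
  case 0
  show ?case by (simp add: ideal_power_0 ideal_iff homog_ideal_def)
next
  case (Suc k)
  have I: "ideal (ideal_power J (Suc k)) mpoly_ring"
    using Suc.prems by (auto simp: homog_ideal_def intro: ideal_ideal_power)
  have "hcomp 0 d F \<in> ideal_power J (Suc k)" if "F \<in> ideal_power J (Suc k)" for d F
    using that[unfolded ideal_power_Suc]
  proof induction
    case (prod F G)
    then have "hcomp 0 a F * hcomp 0 b G \<in> ideal_power J (Suc k)" for a b
      using Suc by (auto simp: ideal_power_Suc homog_ideal_def simp flip: mult_mpoly_ring intro!: ideal_prod.prod)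
    then show ?case
      by (auto simp: hcomp_mult intro!: ideal_sum[OF I])
  next
    case (sum F G)
    then show ?case
      using I by (auto simp: hcomp_add ideal_iff)
  qed
  with I show ?case
    by (auto simp: homog_ideal_def)
qed

lemma ideal_power_mult:
  assumes J: "ideal J mpoly_ring" and "F \<in> ideal_power J a" and "G \<in> ideal_power J b"
  shows "F * G \<in> ideal_power J (a + b)"
  using assms(3)
proof (induction b arbitrary: G)
  case 0
  then show ?case
    using ideal_mult_right[OF ideal_ideal_power[OF J] assms(2)] by simp
next
  case (Suc b)
  have I: "ideal (ideal_power J (a + Suc b)) mpoly_ring"
    by (rule ideal_ideal_power[OF J])
  from Suc.prems[unfolded ideal_power_Suc] show ?case
  proof induction
    case (prod G H)
    with Suc.IH[of G] have "(F * G) \<otimes>\<^bsub>mpoly_ring\<^esub> H \<in> ideal_power J (a + Suc b)"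
      unfolding add_Suc_right ideal_power_Suc by (intro ideal_prod.prod)
    then show ?case by (simp add: mult.assoc)
  next
    case (sum G H)
    with I show ?case by (auto simp: ideal_iff distrib_left)
  qed
qed

lemma ideal_power_Suc_subset: "ideal J mpoly_ring \<Longrightarrow> ideal_power J (Suc k) \<subseteq> ideal_power J k"
  using ring.ideal_prod_inter[OF ring_from_type_algebra ideal_ideal_power, of J J k]
  by (auto simp: ideal_power_Suc)

lemma ideal_power_antimono: "ideal J mpoly_ring \<Longrightarrow> k \<le> l \<Longrightarrow> ideal_power J l \<subseteq> ideal_power J k"
  by (rule lift_Suc_antimono_le[of "ideal_power J"]) (auto dest: ideal_power_Suc_subset)

lemma ideal_power_1: "ideal J mpoly_ring \<Longrightarrow> ideal_power J 1 = J"
proof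
  assume J: "ideal J mpoly_ring"
  interpret cring "mpoly_ring :: ('a, 'b) mpoly ring"
    by (rule cring_from_type_algebra)
  show "ideal_power J 1 \<subseteq> J"
    using ideal_prod_inter[OF ideal_ideal_power[OF J, of 0] J]
    by (auto simp: ideal_power_Suc)
  have "1 \<otimes>\<^bsub>mpoly_ring\<^esub> F \<in> ideal_power J 1" if "F \<in> J" for F
    unfolding One_nat_def ideal_power_Suc using that
    by (intro ideal_prod.prod) (simp_all add: ideal_power_0)
  then show "J \<subseteq> ideal_power J 1"
    by auto
qed

text \<open>For F in J^(k+1) and G in J, the Leibniz rule gives one summand in J^k J by induction
  and another that still contains the factor F. Both lie in J^(k+1).\<close>

lemma partial_deriv_ideal_power:
  assumes J: "ideal J mpoly_ring" and "F \<in> ideal_power J (Suc k)"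
  shows "partial_deriv i F \<in> ideal_power J k"
  using assms(2)
proof (induction k arbitrary: F)
  case 0
  show ?case by (simp add: ideal_power_0)
next
  case (Suc k)
  have I: "ideal (ideal_power J (Suc k)) mpoly_ring"
    by (rule ideal_ideal_power[OF J])
  from Suc.prems[unfolded ideal_power_Suc[of J "Suc k"]] show ?case
  proof induction
    case (prod F G)
    have "partial_deriv i F \<otimes>\<^bsub>mpoly_ring\<^esub> G \<in> ideal_power J (Suc k)"
      unfolding ideal_power_Suc using prod Suc.IH by (intro ideal_prod.prod)
    moreover have "F * partial_deriv i G \<in> ideal_power J (Suc k)"
      using I prod(1) by (rule ideal_mult_right)
    ultimately show ?case
      using I by (simp add: partial_deriv_mult ideal_iff)
  next
    case (sum F G)
    with I show ?case by (auto simp: ideal_iff partial_deriv_add)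
  qed
qed


section \<open>Vanishing ideals of points\<close>

lemma eval_at_single:
  "eval_at a (Poly_Mapping.single e c) = c * (\<Prod>i\<in>UNIV. a i ^ Poly_Mapping.lookup e i)"
  by (simp add: eval_at_def)

lemma eval_at_add: "eval_at a (F + G) = eval_at a F + eval_at a G"
  unfolding eval_at_def
  by (rule setsum_keys_plus_distrib) (simp_all add: distrib_right)

lemma homog_ideal_point_ideal: "homog_ideal (point_ideal a)"
  unfolding point_ideal_def by (rule homog_ideal_genideal) auto

lemma ideal_point_ideal: "ideal (point_ideal a) mpoly_ring"
  using homog_ideal_point_ideal by (auto simp: homog_ideal_def)

text \<open>The linear forms of the overview, with \<open>z\<close> in the role of the index 0. The
  index runs over all variables; the form for \<open>i = z\<close> is 0 once
  \<open>a z \<noteq> 0\<close>, so sums over variables need no exception.\<close>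

definition shifted_var :: "('v \<Rightarrow> 'k::field) \<Rightarrow> 'v \<Rightarrow> 'v \<Rightarrow> ('v, 'k) mpoly" where
  "shifted_var a z i =
     Poly_Mapping.single (Poly_Mapping.single i 1) 1
     - Poly_Mapping.single (Poly_Mapping.single z 1) (a i / a z)"

lemma single_sum: "Poly_Mapping.single e (\<Sum>x\<in>A. f x) = (\<Sum>x\<in>A. Poly_Mapping.single e (f x))"
  by (induction A rule: infinite_finite_induct) (simp_all add: single_add)

lemma prod_power_single:
  "(\<Prod>j\<in>UNIV. (a j :: 'k::comm_monoid_mult) ^ Poly_Mapping.lookup (Poly_Mapping.single (i :: 'v::finite) 1) j) = a i"
  by (simp add: lookup_single when_def if_distrib[of "power _"] cong: if_cong)

lemma single_in_homog_shift: "mon_degree e + k = d \<Longrightarrow> Poly_Mapping.single e c \<in> homog_shift k d"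
  by (auto simp: homog_shift_def)

lemma shifted_var_in_point_ideal:
  assumes "a z \<noteq> 0"
  shows "shifted_var a z i \<in> point_ideal a"
proof -
  have "shifted_var a z i \<in> poly_part 1"
    using single_in_homog_shift[of "Poly_Mapping.single i 1" 0 1 "1 :: 'a"]
      single_in_homog_shift[of "Poly_Mapping.single z 1" 0 1 "a i / a z"]
    by (simp add: shifted_var_def homog_shift_iff hcomp_diff mon_degree_single)
  \<comment> \<open>Written as a sum because only additivity of evaluation is available.\<close>
  moreover have "shifted_var a z i = Poly_Mapping.single (Poly_Mapping.single i 1) 1
     + Poly_Mapping.single (Poly_Mapping.single z 1) (- (a i / a z))"
    by (simp add: shifted_var_def single_uminus)
  then have "eval_at a (shifted_var a z i) = 0"
    using assms by (simp add: eval_at_add eval_at_single prod_power_single del: One_nat_def)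
  ultimately show ?thesis
    unfolding point_ideal_def by (intro subsetD[OF ring.genideal_self[OF ring_from_type_algebra]]) auto
qed

lemma mon_degree_eq_0: "mon_degree e = 0 \<longleftrightarrow> e = 0"
  by (auto simp: mon_degree_def poly_mapping_eq_iff fun_eq_iff)

text \<open>Modulo the linear forms, X_i may be replaced by (a_i/a_z) X_z. Doing this in every
  factor turns a monomial of degree d into a scalar multiple of X_z^d.\<close>

lemma monomial_congruence:
  assumes I: "ideal I mpoly_ring" and Y: "\<And>i. shifted_var a z i \<in> I"
  shows "Poly_Mapping.single e 1 - Poly_Mapping.single (Poly_Mapping.single z (mon_degree e))
    (\<Prod>i\<in>UNIV. (a i / a z) ^ Poly_Mapping.lookup e i) \<in> I"
proof (induction "mon_degree e" arbitrary: e)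
  case 0
  then show ?case
    using ideal_zero[OF I] by (simp add: mon_degree_eq_0 mon_degree_zero)
next
  case (Suc n)
  then have "e \<noteq> 0"
    by (auto simp: mon_degree_zero)
  then obtain i where i: "Poly_Mapping.lookup e i \<noteq> 0"
    by (auto simp: poly_mapping_eq_iff fun_eq_iff)
  define f where "f = e - Poly_Mapping.single i 1"
  have e: "e = Poly_Mapping.single i 1 + f"
    using i unfolding f_def
    by (intro poly_mapping_eqI) (auto simp: lookup_add lookup_minus lookup_single when_def)
  then have n: "mon_degree f = n"
    using Suc(2) by (simp add: mon_degree_add mon_degree_single)
  let ?m = "\<lambda>e. Poly_Mapping.single e (1 :: 'b)"
  let ?b = "\<lambda>e. \<Prod>i\<in>UNIV. (a i / a z) ^ Poly_Mapping.lookup e i"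
  let ?l = "\<lambda>n. Poly_Mapping.single (Poly_Mapping.single z n) :: 'b \<Rightarrow> _"
  have "?b e = a i / a z * ?b f"
    unfolding e lookup_add power_add prod.distrib by (simp only: prod_power_single)
  then have l: "?l (mon_degree e) (?b e) = ?l 1 (a i / a z) * ?l n (?b f)"
    using Suc(2) by (simp add: mult_single flip: single_add)
  have m: "?m e = ?m (Poly_Mapping.single i 1) * ?m f"
    by (subst (1) e) (simp add: mult_single)
  \<comment> \<open>One factor X_i is exchanged for (a_i/a_z) X_z; the cofactor \<open>f\<close> has
    smaller degree and falls under the induction hypothesis.\<close>
  have "?m e - ?l (mon_degree e) (?b e) =
      ?m f * shifted_var a z i + ?l 1 (a i / a z) * (?m f - ?l (mon_degree f) (?b f))"
    unfolding l m n shifted_var_def by (simp add: algebra_simps)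
  also have "\<dots> \<in> I"
    using Suc(1)[of f] n by (intro ideal_add[OF I] ideal_mult_left[OF I] Y) simp
  finally show ?case .
qed

text \<open>This is the claim that the linear forms generate the vanishing ideal: a homogeneous F of
  degree d is congruent to (F(a)/a_z^d) X_z^d, hence to 0 if F(a) = 0. Phrased as minimality, it can
  be applied to the ideal of all elements having a property to be proved.\<close>

lemma point_ideal_subset:
  assumes I: "ideal I mpoly_ring" and Y: "\<And>i. shifted_var a z i \<in> I" and "a z \<noteq> 0"
  shows "point_ideal a \<subseteq> I"
proof -
  have "F \<in> I" if d: "F \<in> poly_part d" and "eval_at a F = 0" for d F
  proof -
    let ?b = "\<lambda>e. \<Prod>i\<in>UNIV. (a i / a z) ^ Poly_Mapping.lookup e i"
    have deg: "mon_degree e = d" if "e \<in> Poly_Mapping.keys F" for e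
      using d that by (simp add: homog_shift_def)
    have b: "?b e = (\<Prod>i\<in>UNIV. a i ^ Poly_Mapping.lookup e i) / a z ^ mon_degree e" for e
      by (simp add: power_divide prod_dividef mon_degree_def power_sum)
    have "(\<Sum>e\<in>Poly_Mapping.keys F. Poly_Mapping.lookup F e * ?b e) = eval_at a F / a z ^ d"
      by (simp add: b eval_at_def sum_divide_distrib deg)
    also have "\<dots> = 0"
      using that by simp
    finally have "(\<Sum>e\<in>Poly_Mapping.keys F. const_poly (Poly_Mapping.lookup F e) *
        Poly_Mapping.single (Poly_Mapping.single z d) (?b e)) = 0"
      by (simp add: const_poly_def mult_single flip: single_sum)
    moreover have "(\<Sum>e\<in>Poly_Mapping.keys F. const_poly (Poly_Mapping.lookup F e) *
        Poly_Mapping.single e 1) = F"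
      by (subst (3) sum_singles) (simp add: const_poly_def mult_single)
    ultimately have "F = (\<Sum>e\<in>Poly_Mapping.keys F. const_poly (Poly_Mapping.lookup F e) *
        (Poly_Mapping.single e 1 - Poly_Mapping.single (Poly_Mapping.single z (mon_degree e)) (?b e)))"
      by (simp add: right_diff_distrib sum_subtractf deg)
    also have "\<dots> \<in> I"
      by (intro ideal_sum[OF I] ideal_mult_left[OF I] monomial_congruence[OF I] Y)
    finally show ?thesis .
  qed
  then show ?thesis
    unfolding point_ideal_def by (intro ring.genideal_minimal[OF ring_from_type_algebra I]) auto
qed

text \<open>The Euler derivation for the coordinates \<open>X\<^sub>i - (a\<^sub>i/a\<^sub>z) X\<^sub>z\<close>.\<close>

definition euler :: "('v::finite \<Rightarrow> 'k::field) \<Rightarrow> 'v \<Rightarrow> ('v, 'k) mpoly \<Rightarrow> ('v, 'k) mpoly" where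
  "euler a z F = (\<Sum>i\<in>UNIV. shifted_var a z i * partial_deriv i F)"

lemma euler_zero: "euler a z 0 = 0"
  by (simp add: euler_def)

lemma euler_add: "euler a z (F + G) = euler a z F + euler a z G"
  by (simp add: euler_def partial_deriv_add distrib_left sum.distrib)

lemma euler_mult: "euler a z (F * G) = euler a z F * G + F * euler a z G"
  by (simp add: euler_def partial_deriv_mult algebra_simps sum.distrib sum_distrib_left)

text \<open>Differentiating gives Y_j - (a_j/a_z) Y_z, and Y_z = 0.\<close>

lemma euler_shifted_var:
  assumes "a z \<noteq> 0"
  shows "euler a z (shifted_var a z j) = shifted_var a z j"
proof -
  have "partial_deriv i (shifted_var a z j) =
      (if i = j then 1 else 0) - (if i = z then const_poly (a j / a z) else 0)" for i
    by (auto simp: shifted_var_def partial_deriv_diff partial_deriv_single lookup_single const_poly_def)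
  then have "euler a z (shifted_var a z j) =
      (\<Sum>i\<in>UNIV. (if i = j then shifted_var a z i else 0)
        - (if i = z then shifted_var a z i * const_poly (a j / a z) else 0))"
    unfolding euler_def by (intro sum.cong) (auto simp: right_diff_distrib)
  also have "\<dots> = shifted_var a z j - shifted_var a z z * const_poly (a j / a z)"
    by (simp add: sum_subtractf)
  also have "shifted_var a z z = 0"
    using assms by (simp add: shifted_var_def)
  finally show ?thesis by simp
qed

text \<open>The coefficients of the derivation are the linear forms, which lie in the vanishing
  ideal and so contribute one more factor.\<close>

lemma euler_in_ideal_power:
  assumes "a z \<noteq> 0" and "\<And>i. partial_deriv i F \<in> ideal_power (point_ideal a) k"
  shows "euler a z F \<in> ideal_power (point_ideal a) (Suc k)"
  unfolding euler_def
proof (rule ideal_sum[OF ideal_ideal_power[OF ideal_point_ideal]])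
  fix i
  have "shifted_var a z i \<in> ideal_power (point_ideal a) 1"
    unfolding ideal_power_1[OF ideal_point_ideal] by (rule shifted_var_in_point_ideal) (rule assms(1))
  from ideal_power_mult[OF ideal_point_ideal this assms(2)[of i]]
  show "shifted_var a z i * partial_deriv i F \<in> ideal_power (point_ideal a) (Suc k)"
    by simp
qed

text \<open>The elements of J satisfying the congruence form an ideal: in E(GF) - GF = G(EF - F) + F
  EG the last term lies in J^2, since EG always lies in J. The linear forms satisfy it exactly, and
  they generate J.\<close>

lemma euler_point_ideal:
  assumes z: "a z \<noteq> 0" and "F \<in> point_ideal a"
  shows "euler a z F - F \<in> ideal_power (point_ideal a) 2"
proof -
  let ?J = "point_ideal a"
  have J: "ideal ?J mpoly_ring" and J2: "ideal (ideal_power ?J 2) mpoly_ring"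
    by (simp_all add: ideal_point_ideal ideal_ideal_power)
  define T where "T = {F\<in>?J. euler a z F - F \<in> ideal_power ?J 2}"
  have "ideal T mpoly_ring"
    unfolding ideal_iff
  proof (intro conjI ballI allI)
    show "0 \<in> T"
      using J J2 by (simp add: T_def euler_zero ideal_zero)
    show "F + G \<in> T" if "F \<in> T" "G \<in> T" for F G
      using that ideal_add[OF J2, of "euler a z F - F" "euler a z G - G"]
      by (simp add: T_def euler_add ideal_add[OF J] algebra_simps)
    show "G * F \<in> T" if "F \<in> T" for F G
    proof -
      have "F \<in> ideal_power ?J 1"
        using that by (simp only: ideal_power_1[OF J]) (simp add: T_def)
      moreover have "euler a z G \<in> ideal_power ?J 1"
        unfolding One_nat_def by (rule euler_in_ideal_power[where k = 0]) (simp_all add: z ideal_power_0)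
      ultimately have "F * euler a z G \<in> ideal_power ?J 2"
        using ideal_power_mult[OF J, of F 1 "euler a z G" 1] by (simp add: numeral_2_eq_2)
      moreover have "euler a z (G * F) - G * F = G * (euler a z F - F) + F * euler a z G"
        by (simp add: euler_mult algebra_simps)
      ultimately show ?thesis
        using that by (auto simp: T_def intro!: ideal_add[OF J2] ideal_mult_left[OF J2] ideal_mult_left[OF J])
    qed
  qed
  moreover have "shifted_var a z i \<in> T" for i
    using z J2 by (simp add: T_def shifted_var_in_point_ideal euler_shifted_var ideal_zero)
  ultimately have "?J \<subseteq> T"
    using z by (rule point_ideal_subset)
  with assms(2) show ?thesis
    by (auto simp: T_def)
qed

text \<open>For F in J^k and G in J the Leibniz rule adds the eigenvalues k and 1. The errors (EF -
  kF) G and F (EG - G) lie in J^(k+1) J and J^k J^2.\<close>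

lemma euler_ideal_power:
  assumes z: "a z \<noteq> 0" and "F \<in> ideal_power (point_ideal a) k"
  shows "euler a z F - of_nat k * F \<in> ideal_power (point_ideal a) (Suc k)"
  using assms(2)
proof (induction k arbitrary: F)
  case 0
  show ?case
    using euler_in_ideal_power[of a z F 0] z by (simp add: ideal_power_0)
next
  case (Suc k)
  let ?J = "point_ideal a"
  have J: "ideal ?J mpoly_ring" and I: "ideal (ideal_power ?J (Suc (Suc k))) mpoly_ring"
    by (simp_all add: ideal_point_ideal ideal_ideal_power)
  from Suc.prems[unfolded ideal_power_Suc[of ?J k]] show ?case
  proof induction
    case (prod F G)
    have "(euler a z F - of_nat k * F) * G \<in> ideal_power ?J (Suc k + 1)"
      using Suc.IH[OF prod(1)] prod(2) by (intro ideal_power_mult[OF J]) (simp_all only: ideal_power_1[OF J])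
    moreover have "F * (euler a z G - G) \<in> ideal_power ?J (k + 2)"
      using prod euler_point_ideal[of a z G] z by (intro ideal_power_mult[OF J]) auto
    moreover have "euler a z (F * G) - of_nat (Suc k) * (F * G) =
        (euler a z F - of_nat k * F) * G + F * (euler a z G - G)"
      by (simp add: euler_mult algebra_simps)
    ultimately show ?case
      using ideal_add[OF I] by simp
  next
    case (sum F G)
    then show ?case
      using ideal_add[OF I, of "euler a z F - of_nat (Suc k) * F" "euler a z G - of_nat (Suc k) * G"]
      by (simp add: euler_add algebra_simps)
  qed
qed

lemma ideal_power_Suc_criterion:
  fixes a :: "'v::finite \<Rightarrow> 'k::field_char_0"
  assumes z: "a z \<noteq> 0" and F: "F \<in> ideal_power (point_ideal a) k" and "k \<noteq> 0"
    and "\<And>i. partial_deriv i F \<in> ideal_power (point_ideal a) k"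
  shows "F \<in> ideal_power (point_ideal a) (Suc k)"
proof -
  have I: "ideal (ideal_power (point_ideal a) (Suc k)) mpoly_ring"
    by (simp add: ideal_point_ideal ideal_ideal_power)
  have "euler a z F - (euler a z F - of_nat k * F) \<in> ideal_power (point_ideal a) (Suc k)"
    by (intro ideal_diff[OF I] euler_in_ideal_power euler_ideal_power assms)
  \<comment> \<open>Dividing by k is multiplying by the constant polynomial 1/k; this uses
    characteristic zero and \<open>k \<noteq> 0\<close>.\<close>
  then have "const_poly (1 / of_nat k) * (of_nat k * F) \<in> ideal_power (point_ideal a) (Suc k)"
    by (simp add: ideal_mult_left[OF I])
  also have "const_poly (1 / of_nat k) * (of_nat k * F) = const_poly (1 / of_nat k * of_nat k) * F"
    unfolding const_poly_mult mult.assoc by (simp add: const_poly_def)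
  finally show ?thesis
    using \<open>k \<noteq> 0\<close> by (simp add: const_poly_one)
qed


section \<open>Ideals of fat points\<close>

lemma fat_ideal_eq: "fat_ideal s P m = (\<Inter>j\<in>{1..s}. ideal_power (point_ideal (P j)) (m j))"
  by (simp add: fat_ideal_def ideal_power_def)

lemma homog_ideal_fat_ideal: "homog_ideal (fat_ideal s P m)"
proof -
  have "homog_ideal (ideal_power (point_ideal (P j)) (m j))" for j
    by (intro homog_ideal_power homog_ideal_point_ideal)
  then show ?thesis
    by (auto simp: fat_ideal_eq homog_ideal_def ideal_iff)
qed

lemma fat_ideal_antimono:
  assumes "\<And>j. j \<in> {1..s} \<Longrightarrow> m j \<le> m' j"
  shows "fat_ideal s P m' \<subseteq> fat_ideal s P m"
  unfolding fat_ideal_eq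
  by (intro INF_superset_mono order_refl ideal_power_antimono ideal_point_ideal assms)

lemma fat_ideal_mult:
  assumes "F \<in> fat_ideal s P m" and "G \<in> fat_ideal s P m'"
    and "\<And>j. j \<in> {1..s} \<Longrightarrow> m'' j \<le> m j + m' j"
  shows "F * G \<in> fat_ideal s P m''"
proof -
  have "F * G \<in> fat_ideal s P (\<lambda>j. m j + m' j)"
    using assms(1,2) by (auto simp: fat_ideal_eq intro!: ideal_power_mult[OF ideal_point_ideal])
  then show ?thesis
    using fat_ideal_antimono[of s m'' "\<lambda>j. m j + m' j" P] assms(3) by auto
qed

lemma fattening_fattening: "fattening (fattening m i) j = fattening m (i + j)"
  by (simp add: fattening_def add.assoc)

lemma partial_deriv_fat_ideal:
  "F \<in> fat_ideal s P (fattening m 1) \<Longrightarrow> partial_deriv i F \<in> fat_ideal s P m"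
  by (auto simp: fat_ideal_eq fattening_def intro!: partial_deriv_ideal_power[OF ideal_point_ideal])

text \<open>Since fat point ideals are intersections, the criterion for a single point applies to
  each \<open>j\<close> with its own exponent. One coordinate \<open>z\<close> serves all points
  because none of them lies on X_z = 0.\<close>

lemma fat_ideal_fattening_criterion:
  fixes P :: "nat \<Rightarrow> 'v::finite \<Rightarrow> 'k::field_char_0"
  assumes "\<And>j. j \<in> {1..s} \<Longrightarrow> P j z \<noteq> 0" and "\<And>j. j \<in> {1..s} \<Longrightarrow> m j \<noteq> 0"
    and "F \<in> fat_ideal s P m" and "\<And>i. partial_deriv i F \<in> fat_ideal s P m"
  shows "F \<in> fat_ideal s P (fattening m 1)"
  using assms by (auto simp: fat_ideal_eq fattening_def intro!: ideal_power_Suc_criterion[of "P _" z])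


section \<open>Graded subquotients\<close>

text \<open>The common interface of S, Omega^1 and Omega^2. Addition and zero are those of the type,
  so that sums and differences are ordinary ones. The grading is given by projections
  \<open>pr\<close>, with the graded parts as their fixed points inside the carrier.\<close>

locale graded_forms =
  fixes M :: "(('v::finite, 'k::field) mpoly, 'b::ab_group_add) module"
    and G :: "nat \<Rightarrow> 'b set" and pr :: "nat \<Rightarrow> 'b \<Rightarrow> 'b"
  assumes add_M [simp]: "x \<oplus>\<^bsub>M\<^esub> y = x + y" and zero_M [simp]: "\<zero>\<^bsub>M\<^esub> = 0"
    and carrier_zero: "0 \<in> carrier M"
    and carrier_add: "x \<in> carrier M \<Longrightarrow> y \<in> carrier M \<Longrightarrow> x + y \<in> carrier M"
    and carrier_smult: "x \<in> carrier M \<Longrightarrow> r \<odot>\<^bsub>M\<^esub> x \<in> carrier M"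
    and smult_add_left: "(r + t) \<odot>\<^bsub>M\<^esub> x = r \<odot>\<^bsub>M\<^esub> x + t \<odot>\<^bsub>M\<^esub> x"
    and smult_add_right: "r \<odot>\<^bsub>M\<^esub> (x + y) = r \<odot>\<^bsub>M\<^esub> x + r \<odot>\<^bsub>M\<^esub> y"
    and smult_assoc: "(r * t) \<odot>\<^bsub>M\<^esub> x = r \<odot>\<^bsub>M\<^esub> (t \<odot>\<^bsub>M\<^esub> x)"
    and smult_one [simp]: "1 \<odot>\<^bsub>M\<^esub> x = x"
    and pr_carrier: "x \<in> carrier M \<Longrightarrow> pr d x \<in> carrier M"
    and pr_add: "pr d (x + y) = pr d x + pr d y"
    and pr_pr: "pr d (pr e x) = (if d = e then pr e x else 0)"
    and finite_pr: "finite {d. pr d x \<noteq> 0}"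
    and sum_pr: "(\<Sum>d | pr d x \<noteq> 0. pr d x) = x"
    and G_iff: "G d = {x \<in> carrier M. pr d x = x}"
    and smult_G: "r \<in> poly_part a \<Longrightarrow> x \<in> G b \<Longrightarrow> r \<odot>\<^bsub>M\<^esub> x \<in> G (a + b)"
begin

text \<open>Homogeneous submodules; negation comes from the scalar \<open>- 1\<close>, and
  homogeneity is again stability under projections.\<close>

definition hsub :: "'b set \<Rightarrow> bool" where
  "hsub N \<longleftrightarrow> N \<subseteq> carrier M \<and> 0 \<in> N \<and> (\<forall>x\<in>N. \<forall>y\<in>N. x + y \<in> N) \<and>
     (\<forall>r. \<forall>x\<in>N. r \<odot>\<^bsub>M\<^esub> x \<in> N) \<and> (\<forall>d. \<forall>x\<in>N. pr d x \<in> N)"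

lemma smult_zero_left [simp]: "0 \<odot>\<^bsub>M\<^esub> x = 0"
  using smult_add_left[of 0 0 x] by simp

lemma smult_zero_right [simp]: "r \<odot>\<^bsub>M\<^esub> 0 = 0"
  using smult_add_right[of r 0 0] by simp

lemma smult_minus_one: "(- 1) \<odot>\<^bsub>M\<^esub> x = - x"
  using smult_add_left[of 1 "- 1" x] by (simp add: eq_neg_iff_add_eq_0 add.commute)

lemma pr_zero [simp]: "pr d 0 = 0"
  using pr_add[of d 0 0] by simp

lemma pr_uminus: "pr d (- x) = - pr d x"
  using pr_add[of d x "- x"] by (simp add: eq_neg_iff_add_eq_0 add.commute)

lemma pr_diff: "pr d (x - y) = pr d x - pr d y"
  using pr_add[of d x "- y"] by (simp add: pr_uminus)

lemma pr_sum: "pr d (\<Sum>a\<in>A. f a) = (\<Sum>a\<in>A. pr d (f a))"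
  by (induction A rule: infinite_finite_induct) (simp_all add: pr_add)

lemma hsubD:
  assumes "hsub N"
  shows hsub_carrier: "N \<subseteq> carrier M" and hsub_zero: "0 \<in> N"
    and hsub_add: "x \<in> N \<Longrightarrow> y \<in> N \<Longrightarrow> x + y \<in> N"
    and hsub_smult: "x \<in> N \<Longrightarrow> r \<odot>\<^bsub>M\<^esub> x \<in> N"
    and hsub_pr: "x \<in> N \<Longrightarrow> pr d x \<in> N"
    and hsub_uminus: "x \<in> N \<Longrightarrow> - x \<in> N"
    and hsub_diff: "x \<in> N \<Longrightarrow> y \<in> N \<Longrightarrow> x - y \<in> N"
proof -
  show *: "x + y \<in> N" if "x \<in> N" "y \<in> N" for x y
    using assms that by (simp add: hsub_def)
  show **: "- x \<in> N" if "x \<in> N" for x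
    using assms that by (metis hsub_def smult_minus_one)
  show "x - y \<in> N" if "x \<in> N" "y \<in> N" for x y
    using *[OF that(1) **[OF that(2)]] by simp
qed (use assms in \<open>auto simp: hsub_def\<close>)

lemma hsub_sum: "hsub N \<Longrightarrow> (\<And>a. a \<in> A \<Longrightarrow> f a \<in> N) \<Longrightarrow> (\<Sum>a\<in>A. f a) \<in> N"
  by (induction A rule: infinite_finite_induct) (auto simp: hsub_zero hsub_add)

lemma hsub_carrier_M: "hsub (carrier M)"
  by (auto simp: hsub_def carrier_zero carrier_add carrier_smult pr_carrier)

lemma mem_coset: "y \<in> N +>\<^bsub>M\<^esub> x \<longleftrightarrow> y - x \<in> N"
  by (auto simp: a_r_coset_def' intro!: bexI[of _ "y - x"])

lemma coset_0 [simp]: "N +>\<^bsub>M\<^esub> 0 = N"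
  by (auto simp: mem_coset)

lemma coset_eq_iff:
  assumes "hsub N"
  shows "N +>\<^bsub>M\<^esub> x = N +>\<^bsub>M\<^esub> y \<longleftrightarrow> x - y \<in> N"
proof
  have "x \<in> N +>\<^bsub>M\<^esub> x"
    using assms by (simp add: mem_coset hsub_zero)
  then show "x - y \<in> N" if "N +>\<^bsub>M\<^esub> x = N +>\<^bsub>M\<^esub> y"
    using that by (simp add: mem_coset)
  assume xy: "x - y \<in> N"
  have "z - x \<in> N \<longleftrightarrow> z - y \<in> N" for z
    using hsub_add[OF assms _ xy, of "z - x"] hsub_diff[OF assms _ xy, of "z - y"] by auto
  then show "N +>\<^bsub>M\<^esub> x = N +>\<^bsub>M\<^esub> y"
    by (auto simp: mem_coset)
qed

lemma coset_eq_zero_iff: "hsub N \<Longrightarrow> N +>\<^bsub>M\<^esub> x = N \<longleftrightarrow> x \<in> N"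
  using coset_eq_iff[of N x 0] by simp

lemma coset_add:
  assumes "hsub N"
  shows "(N +>\<^bsub>M\<^esub> x) <+>\<^bsub>M\<^esub> (N +>\<^bsub>M\<^esub> y) = N +>\<^bsub>M\<^esub> (x + y)"
proof -
  have "z \<in> (N +>\<^bsub>M\<^esub> x) <+>\<^bsub>M\<^esub> (N +>\<^bsub>M\<^esub> y) \<longleftrightarrow> z \<in> N +>\<^bsub>M\<^esub> (x + y)" for z
  proof
    assume "z \<in> (N +>\<^bsub>M\<^esub> x) <+>\<^bsub>M\<^esub> (N +>\<^bsub>M\<^esub> y)"
    then obtain u v where "z = u + v" "u - x \<in> N" "v - y \<in> N"
      by (auto simp: set_add_def' mem_coset)
    then show "z \<in> N +>\<^bsub>M\<^esub> (x + y)"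
      using hsub_add[OF assms, of "u - x" "v - y"] by (simp add: mem_coset algebra_simps)
  next
    assume "z \<in> N +>\<^bsub>M\<^esub> (x + y)"
    then show "z \<in> (N +>\<^bsub>M\<^esub> x) <+>\<^bsub>M\<^esub> (N +>\<^bsub>M\<^esub> y)"
      using assms hsub_zero[OF assms] unfolding set_add_def' add_M
      by (intro UN_I[of "z - y"] UN_I[of y]) (simp_all add: mem_coset algebra_simps)
  qed
  then show ?thesis by blast
qed

lemma module_M: "Module.module mpoly_ring M"
  by (rule module_criteria)
    (auto simp: carrier_zero carrier_add carrier_smult smult_add_left smult_add_right smult_assoc
      add_ac intro: hsub_uminus[OF hsub_carrier_M] bexI[of _ "- _"])

end

lemma mem_ring_coset: "a \<in> I +>\<^bsub>(ring_of_type_algebra :: 'a::comm_ring_1 ring)\<^esub> r \<longleftrightarrow> a - r \<in> I"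
  by (auto simp: a_r_coset_def' intro!: bexI[of _ "a - r"])

lemma coord_ring_simps:
  fixes I :: "('v, 'k::comm_ring_1) mpoly set"
  assumes I: "ideal I mpoly_ring"
  shows carrier_coord_ring: "carrier (coord_ring I) = {I +>\<^bsub>mpoly_ring\<^esub> r | r. True}"
    and mult_coord_ring: "(I +>\<^bsub>mpoly_ring\<^esub> r) \<otimes>\<^bsub>coord_ring I\<^esub> (I +>\<^bsub>mpoly_ring\<^esub> t) = I +>\<^bsub>mpoly_ring\<^esub> (r * t)"
    and add_coord_ring: "(I +>\<^bsub>mpoly_ring\<^esub> r) \<oplus>\<^bsub>coord_ring I\<^esub> (I +>\<^bsub>mpoly_ring\<^esub> t) = I +>\<^bsub>mpoly_ring\<^esub> (r + t)"
    and one_coord_ring: "\<one>\<^bsub>coord_ring I\<^esub> = I +>\<^bsub>mpoly_ring\<^esub> 1"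
    and zero_coord_ring: "\<zero>\<^bsub>coord_ring I\<^esub> = I"
  using ideal.rcoset_mult_add[OF I, of r t] ideal.a_rcos_sum[OF I, of r t]
  by (auto simp: FactRing_def A_RCOSETS_def')

lemma cring_coord_ring: "ideal I mpoly_ring \<Longrightarrow> cring (coord_ring I)"
  by (intro ideal.quotient_is_cring cring_from_type_algebra)

text \<open>\<open>ann\<close> says that I U lies in N, which makes the action of cosets of I on U/N
  independent of representatives. A proper submodule \<open>U\<close> is needed for the two left
  terms of the sequence.\<close>

locale graded_subquotient = graded_forms M G pr
  for M :: "(('v::finite, 'k::field) mpoly, 'b::ab_group_add) module" and G pr +
  fixes I :: "('v, 'k) mpoly set" and U N :: "'b set"
  assumes hU: "hsub U" and hN: "hsub N" and NU: "N \<subseteq> U"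
    and hI: "homog_ideal I" and ann: "r \<in> I \<Longrightarrow> x \<in> U \<Longrightarrow> r \<odot>\<^bsub>M\<^esub> x \<in> N"
begin

abbreviation "Q \<equiv> subquotient M U N"
abbreviation "QG \<equiv> subquotient_part M G U N"

lemma I: "ideal I mpoly_ring"
  using hI by (simp add: homog_ideal_def)

lemma carrier_Q: "carrier Q = {N +>\<^bsub>M\<^esub> x | x. x \<in> U}"
  and zero_Q: "\<zero>\<^bsub>Q\<^esub> = N"
  by (simp_all add: subquotient_def)

lemma add_Q: "(N +>\<^bsub>M\<^esub> x) \<oplus>\<^bsub>Q\<^esub> (N +>\<^bsub>M\<^esub> y) = N +>\<^bsub>M\<^esub> (x + y)"
  by (simp add: subquotient_def coset_add[OF hN])

text \<open>For other representatives a and y, the difference a y - r x = a (y - x) + (a - r) x lies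
  in N: the first summand because N is a submodule, the second by \<open>ann\<close>. The union in
  the definition thus ranges over equal sets and collapses.\<close>

lemma smult_Q:
  assumes "x \<in> U"
  shows "(I +>\<^bsub>mpoly_ring\<^esub> r) \<odot>\<^bsub>Q\<^esub> (N +>\<^bsub>M\<^esub> x) = N +>\<^bsub>M\<^esub> (r \<odot>\<^bsub>M\<^esub> x)"
proof -
  have eq: "N +>\<^bsub>M\<^esub> (a \<odot>\<^bsub>M\<^esub> y) = N +>\<^bsub>M\<^esub> (r \<odot>\<^bsub>M\<^esub> x)"
    if "a \<in> I +>\<^bsub>mpoly_ring\<^esub> r" "y \<in> N +>\<^bsub>M\<^esub> x" for a y
  proof -
    have "a \<odot>\<^bsub>M\<^esub> y - r \<odot>\<^bsub>M\<^esub> x = a \<odot>\<^bsub>M\<^esub> (y - x) + (a - r) \<odot>\<^bsub>M\<^esub> x"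
      using smult_add_right[of a "y - x" x] smult_add_left[of "a - r" r x] by (simp add: algebra_simps)
    also have "\<dots> \<in> N"
      using that assms by (intro hsub_add[OF hN] hsub_smult[OF hN] ann) (auto simp: mem_coset mem_ring_coset)
    finally show ?thesis
      by (simp add: coset_eq_iff[OF hN])
  qed
  have ne: "r \<in> I +>\<^bsub>mpoly_ring\<^esub> r" "x \<in> N +>\<^bsub>M\<^esub> x"
    using ideal_zero[OF I] hsub_zero[OF hN] by (simp_all add: mem_coset mem_ring_coset)
  have "(I +>\<^bsub>mpoly_ring\<^esub> r) \<odot>\<^bsub>Q\<^esub> (N +>\<^bsub>M\<^esub> x) =
      (\<Union>a\<in>I +>\<^bsub>mpoly_ring\<^esub> r. \<Union>y\<in>N +>\<^bsub>M\<^esub> x. N +>\<^bsub>M\<^esub> (a \<odot>\<^bsub>M\<^esub> y))"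
    by (simp add: subquotient_def)
  also have "\<dots> = (\<Union>a\<in>I +>\<^bsub>mpoly_ring\<^esub> r. \<Union>y\<in>N +>\<^bsub>M\<^esub> x. N +>\<^bsub>M\<^esub> (r \<odot>\<^bsub>M\<^esub> x))"
    by (intro SUP_cong refl eq)
  also have "\<dots> = N +>\<^bsub>M\<^esub> (r \<odot>\<^bsub>M\<^esub> x)"
    using ne by blast
  finally show ?thesis .
qed

lemma module_Q: "Module.module (coord_ring I) Q"
proof -
  note [simp] = add_Q smult_Q carrier_coord_ring[OF I] mult_coord_ring[OF I] add_coord_ring[OF I]
    one_coord_ring[OF I]
  have zero: "\<zero>\<^bsub>Q\<^esub> = N +>\<^bsub>M\<^esub> 0"
    by (simp add: zero_Q)
  have neg: "\<exists>B\<in>carrier Q. A \<oplus>\<^bsub>Q\<^esub> B = \<zero>\<^bsub>Q\<^esub>" if A: "A \<in> carrier Q" for A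
  proof -
    obtain x where "A = N +>\<^bsub>M\<^esub> x" "x \<in> U"
      using A by (auto simp: carrier_Q)
    then show ?thesis
      by (intro bexI[of _ "N +>\<^bsub>M\<^esub> (- x)"]) (auto simp: carrier_Q zero_Q hsub_uminus[OF hU])
  qed
  show ?thesis
    apply (rule module_criteria[OF cring_coord_ring[OF I]])
    subgoal using hsub_zero[OF hU] zero by (auto simp only: carrier_Q)
    subgoal using hsub_add[OF hU] by (force simp: carrier_Q)
    subgoal using neg by blast
    subgoal using hsub_smult[OF hU] by (auto simp: carrier_Q)
    subgoal by (auto simp: carrier_Q add.commute)
    subgoal by (auto simp: carrier_Q add.assoc)
    subgoal by (auto simp: carrier_Q zero simp del: coset_0)
    subgoal using hsub_smult[OF hU] by (auto simp: carrier_Q smult_assoc)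
    subgoal by (auto simp: carrier_Q)
    subgoal using hsub_smult[OF hU] by (auto simp: carrier_Q smult_add_left)
    subgoal using hsub_smult[OF hU] hsub_add[OF hU] by (auto simp: carrier_Q smult_add_right)
    done
qed

lemma abelian_group_Q: "abelian_group Q"
  by (rule Module.module.axioms(2)[OF module_Q])

lemma finsum_Q:
  assumes "finite A" and "\<And>a. a \<in> A \<Longrightarrow> g a \<in> U"
  shows "finsum Q (\<lambda>a. N +>\<^bsub>M\<^esub> g a) A = N +>\<^bsub>M\<^esub> (\<Sum>a\<in>A. g a)"
  using assms
proof (induction A rule: finite_induct)
  case empty
  interpret Q: abelian_group Q by (rule abelian_group_Q)
  show ?case by (simp add: zero_Q)
next
  case (insert a A)
  interpret Q: abelian_group Q by (rule abelian_group_Q)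
  from insert show ?case
    by (subst Q.finsum_insert) (auto simp: carrier_Q add_Q)
qed

lemma minus_Q: "x \<in> U \<Longrightarrow> \<ominus>\<^bsub>Q\<^esub> (N +>\<^bsub>M\<^esub> x) = N +>\<^bsub>M\<^esub> (- x)"
  using abelian_group.minus_equality[OF abelian_group_Q, of "N +>\<^bsub>M\<^esub> (- x)" "N +>\<^bsub>M\<^esub> x"]
  by (force simp: carrier_Q add_Q zero_Q hsub_uminus[OF hU])

lemma mem_G: "x \<in> G d \<longleftrightarrow> x \<in> carrier M \<and> pr d x = x"
  by (simp add: G_iff)

lemma subgroup_QG: "subgroup (QG d) (add_monoid Q)"
proof
  show "QG d \<subseteq> carrier (add_monoid Q)"
    by (auto simp: subquotient_part_def carrier_Q)
  show "A \<otimes>\<^bsub>add_monoid Q\<^esub> B \<in> QG d" if XY: "A \<in> QG d" "B \<in> QG d" for A B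
  proof -
    obtain x y where "A = N +>\<^bsub>M\<^esub> x" "B = N +>\<^bsub>M\<^esub> y" "x \<in> U" "y \<in> U" "x \<in> G d" "y \<in> G d"
      using XY by (auto simp: subquotient_part_def)
    then show ?thesis
      by (auto simp: add_Q subquotient_part_def mem_G pr_add carrier_add hsub_add[OF hU]
          intro!: exI[of _ "x + y"])
  qed
  show "\<one>\<^bsub>add_monoid Q\<^esub> \<in> QG d"
    by (auto simp: zero_Q subquotient_part_def mem_G carrier_zero hsub_zero[OF hU] intro!: exI[of _ 0])
  show "inv\<^bsub>add_monoid Q\<^esub> A \<in> QG d" if A: "A \<in> QG d" for A
  proof -
    obtain x where x: "A = N +>\<^bsub>M\<^esub> x" "x \<in> U" "x \<in> G d"
      using A by (auto simp: subquotient_part_def)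
    then have "inv\<^bsub>add_monoid Q\<^esub> A = N +>\<^bsub>M\<^esub> (- x)"
      unfolding a_inv_def[symmetric] by (simp add: minus_Q)
    also have "\<dots> \<in> QG d"
      using x by (auto simp: subquotient_part_def mem_G pr_uminus hsub_uminus[OF hU]
          hsub_uminus[OF hsub_carrier_M])
    finally show ?thesis .
  qed
qed

text \<open>Existence projects a representative. For uniqueness, homogeneous representatives of a
  second decomposition are compared with \<open>u\<close> by applying each projection, which
  preserves N.\<close>

lemma decomposition_Q:
  assumes u: "u \<in> U"
  shows "\<exists>!f. (\<forall>d. f d \<in> QG d) \<and> finite {d. f d \<noteq> \<zero>\<^bsub>Q\<^esub>} \<and>
    N +>\<^bsub>M\<^esub> u = finsum Q f {d. f d \<noteq> \<zero>\<^bsub>Q\<^esub>}"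
proof (rule ex1I)
  define f where "f = (\<lambda>d. N +>\<^bsub>M\<^esub> pr d u)"
  have prU: "pr d u \<in> U" for d
    using u by (rule hsub_pr[OF hU])
  have fd: "f d \<noteq> \<zero>\<^bsub>Q\<^esub> \<longleftrightarrow> pr d u \<notin> N" for d
    by (simp add: f_def zero_Q coset_eq_zero_iff[OF hN])
  \<comment> \<open>A nonzero component of \<open>u\<close> may lie in N and vanish in the quotient.
    The two sums then differ by components in N only.\<close>
  have sub: "{d. f d \<noteq> \<zero>\<^bsub>Q\<^esub>} \<subseteq> {d. pr d u \<noteq> 0}"
    using hsub_zero[OF hN] by (auto simp: fd)
  have fin: "finite {d. f d \<noteq> \<zero>\<^bsub>Q\<^esub>}"
    by (rule finite_subset[OF sub finite_pr])
  have "u - (\<Sum>d | f d \<noteq> \<zero>\<^bsub>Q\<^esub>. pr d u) = (\<Sum>d | pr d u \<noteq> 0. pr d u) - (\<Sum>d | f d \<noteq> \<zero>\<^bsub>Q\<^esub>. pr d u)"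
    by (simp add: sum_pr)
  also have "\<dots> = (\<Sum>d\<in>{d. pr d u \<noteq> 0} - {d. f d \<noteq> \<zero>\<^bsub>Q\<^esub>}. pr d u)"
    by (rule sum_diff[OF finite_pr sub, symmetric])
  also have "\<dots> \<in> N"
    by (intro hsub_sum[OF hN]) (auto simp: fd)
  finally have "N +>\<^bsub>M\<^esub> u = finsum Q f {d. f d \<noteq> \<zero>\<^bsub>Q\<^esub>}"
    unfolding f_def by (subst finsum_Q) (use fin prU in \<open>auto simp: coset_eq_iff[OF hN] f_def\<close>)
  moreover have "f d \<in> QG d" for d
    using u prU pr_carrier[of u d] hsub_carrier[OF hU]
    by (auto simp: f_def subquotient_part_def mem_G pr_pr intro!: exI[of _ "pr d u"])
  ultimately show "(\<forall>d. f d \<in> QG d) \<and> finite {d. f d \<noteq> \<zero>\<^bsub>Q\<^esub>} \<and>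
    N +>\<^bsub>M\<^esub> u = finsum Q f {d. f d \<noteq> \<zero>\<^bsub>Q\<^esub>}"
    using fin by blast
  fix g assume g: "(\<forall>d. g d \<in> QG d) \<and> finite {d. g d \<noteq> \<zero>\<^bsub>Q\<^esub>} \<and>
    N +>\<^bsub>M\<^esub> u = finsum Q g {d. g d \<noteq> \<zero>\<^bsub>Q\<^esub>}"
  define D where "D = {d. g d \<noteq> \<zero>\<^bsub>Q\<^esub>}"
  from g have "\<forall>d. \<exists>x. g d = N +>\<^bsub>M\<^esub> x \<and> x \<in> U \<and> x \<in> G d"
    by (auto simp: subquotient_part_def)
  then obtain h where h: "\<And>d. g d = N +>\<^bsub>M\<^esub> h d" "\<And>d. h d \<in> U" "\<And>d. h d \<in> G d"
    by metis
  then have g_eq: "g = (\<lambda>d. N +>\<^bsub>M\<^esub> h d)"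
    by blast
  have finD: "finite D"
    using g by (simp add: D_def)
  have "N +>\<^bsub>M\<^esub> u = finsum Q g D"
    using g by (simp add: D_def)
  also have "\<dots> = N +>\<^bsub>M\<^esub> (\<Sum>d\<in>D. h d)"
    unfolding g_eq by (rule finsum_Q[OF finD h(2)])
  finally have diff: "u - (\<Sum>d\<in>D. h d) \<in> N"
    by (simp add: coset_eq_iff[OF hN])
  show "g = f"
  proof
    fix e
    \<comment> \<open>The chosen representatives are homogeneous, so the projection to degree
      \<open>e\<close> isolates a single one of them.\<close>
    have prh: "pr e (h d) = (if e = d then h d else 0)" for d
      using h(3)[of d] pr_pr[of e d "h d"] by (simp add: mem_G)
    have "pr e (u - (\<Sum>d\<in>D. h d)) \<in> N"
      using diff by (rule hsub_pr[OF hN])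
    also have "pr e (u - (\<Sum>d\<in>D. h d)) = pr e u - (if e \<in> D then h e else 0)"
      using finD by (simp add: pr_diff pr_sum prh)
    finally have *: "pr e u - (if e \<in> D then h e else 0) \<in> N" .
    show "g e = f e"
    proof (cases "e \<in> D")
      case True
      with * show ?thesis
        using hsub_uminus[OF hN *] by (simp add: h(1) f_def coset_eq_iff[OF hN])
    next
      case False
      then have "g e = N" by (simp add: D_def zero_Q)
      moreover from False * have "f e = N"
        by (simp add: f_def coset_eq_zero_iff[OF hN])
      ultimately show ?thesis by simp
    qed
  qed
qed

lemma is_grading_Q: "is_grading Q QG"
  unfolding is_grading_def
proof (intro conjI allI ballI subgroup_QG)
  fix A assume "A \<in> carrier Q"
  then obtain u where "u \<in> U" "A = N +>\<^bsub>M\<^esub> u"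
    by (auto simp: carrier_Q)
  with decomposition_Q[of u] show "\<exists>!f. (\<forall>d. f d \<in> QG d) \<and> finite {d. f d \<noteq> \<zero>\<^bsub>Q\<^esub>} \<and>
    A = finsum Q f {d. f d \<noteq> \<zero>\<^bsub>Q\<^esub>}"
    by simp
qed

end

section \<open>The polynomial ring as a graded module, and coordinate rings\<close>

lemma regular_mpoly_ring [simp]:
  fixes F :: "'a::comm_ring_1"
  defines "S \<equiv> (ring_of_type_algebra :: 'a ring)"
  shows "carrier (regular_module S) = UNIV"
    and "F \<oplus>\<^bsub>regular_module S\<^esub> F' = F + F'" and "\<zero>\<^bsub>regular_module S\<^esub> = 0"
    and "F \<odot>\<^bsub>regular_module S\<^esub> F' = F * F'"
  by (simp_all add: S_def regular_module_def ring_of_type_algebra_def ring.defs module.defs)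

interpretation polys: graded_forms "regular_module mpoly_ring :: (('v::finite, 'k::field) mpoly, _) module"
  poly_part "hcomp 0"
  by unfold_locales
    (auto simp: algebra_simps hcomp_add hcomp_hcomp finite_hcomp_support sum_hcomp homog_shift_iff
      intro: homog_shift_mult[unfolded homog_shift_iff])

lemma hsub_polys_iff: "polys.hsub I \<longleftrightarrow> homog_ideal I"
  by (auto simp: polys.hsub_def homog_ideal_def ideal_iff)

lemma coset_regular: "I +>\<^bsub>regular_module R\<^esub> x = I +>\<^bsub>R\<^esub> x"
  by (simp add: a_r_coset_def' regular_module_def ring.defs module.defs)

lemma graded_subquotient_polys:
  assumes "homog_ideal I" "homog_ideal J" "homog_ideal J'" "J' \<subseteq> J"
    and "\<And>F G. F \<in> I \<Longrightarrow> G \<in> J \<Longrightarrow> F * G \<in> J'"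
  shows "graded_subquotient (regular_module mpoly_ring) poly_part (hcomp 0) I J J'"
  by unfold_locales
    (use assms in \<open>auto simp: hsub_polys_iff\<close>)

text \<open>A grading involves only the additive group, so it can be moved between a ring and a
  module that share this group.\<close>

lemma is_grading_cong:
  assumes "carrier M = carrier M'" "zero M = zero M'" "add M = add M'"
  shows "is_grading M G \<longleftrightarrow> is_grading M' G"
proof -
  have "subgroup H (add_monoid M) \<longleftrightarrow> subgroup H (add_monoid M')" for H
    by (simp add: subgroup_def m_inv_def assms)
  moreover have "finsum M f D = finsum M' f D" for f :: "nat \<Rightarrow> _" and D
    by (simp add: finsum_def finprod_def assms)
  ultimately show ?thesis
    by (simp add: is_grading_def assms)
qed

lemma graded_ring_coord_ring:
  fixes I :: "('v::finite, 'k::field) mpoly set"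
  assumes hI: "homog_ideal I"
  shows "graded_ring (coord_ring I) (coord_ring_part I)"
proof -
  have I: "ideal I mpoly_ring"
    using hI by (simp add: homog_ideal_def)
  \<comment> \<open>The coordinate ring is additively the subquotient S/I of the regular module,
    whose grading has already been established.\<close>
  interpret graded_subquotient "regular_module mpoly_ring" poly_part "hcomp 0" I UNIV I
    by (rule graded_subquotient_polys)
      (use hI I in \<open>auto simp: homog_ideal_def ideal_iff ideal_mult_right\<close>)
  have QG: "QG = coord_ring_part I"
    by (auto simp: fun_eq_iff subquotient_part_def coord_ring_part_def coset_regular)
  have "is_grading (coord_ring I) (coord_ring_part I)"
  proof (subst is_grading_cong)
    show "carrier (coord_ring I) = carrier Q"
      by (auto simp: carrier_Q carrier_coord_ring[OF I] coset_regular)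
    show "zero (coord_ring I) = zero Q"
      by (simp add: zero_Q zero_coord_ring[OF I])
    show "add (coord_ring I) = add Q"
      by (simp add: subquotient_def FactRing_def fun_eq_iff set_add_def' regular_module_def ring.defs module.defs)
    show "is_grading Q (coord_ring_part I)"
      using is_grading_Q by (simp add: QG)
  qed
  moreover have "\<one>\<^bsub>coord_ring I\<^esub> \<in> coord_ring_part I 0"
    using const_poly_in_poly_part[of 1] by (auto simp: one_coord_ring[OF I] coord_ring_part_def const_poly_one)
  moreover have "r \<otimes>\<^bsub>coord_ring I\<^esub> t \<in> coord_ring_part I (a + b)"
    if "r \<in> coord_ring_part I a" "t \<in> coord_ring_part I b" for a b r t
    using that by (auto simp: coord_ring_part_def mult_coord_ring[OF I] intro: homog_shift_mult)
  ultimately show ?thesis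
    by (auto simp: graded_ring_def cring_coord_ring[OF I])
qed

context graded_subquotient
begin

text \<open>Proved only after leaving the locale once: the graded ring S/I over which
  \<open>Q\<close> is graded comes from another instance of the same locale.\<close>

lemma graded_module_Q: "graded_module (coord_ring I) (coord_ring_part I) Q QG"
proof -
  have "r \<odot>\<^bsub>Q\<^esub> x \<in> QG (a + b)" if r: "r \<in> coord_ring_part I a" and x: "x \<in> QG b" for a b r x
  proof -
    obtain F y where "r = I +>\<^bsub>mpoly_ring\<^esub> F" "F \<in> poly_part a" "x = N +>\<^bsub>M\<^esub> y" "y \<in> U" "y \<in> G b"
      using r x by (auto simp: coord_ring_part_def subquotient_part_def)
    then show ?thesis
      by (auto simp: smult_Q subquotient_part_def smult_G hsub_smult[OF hU])
  qed
  then show ?thesis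
    by (auto simp: graded_module_def graded_ring_coord_ring[OF hI] module_Q is_grading_Q)
qed

end

text \<open>The induced map without a choice of representative: the union runs over equal cosets
  whenever \<open>f\<close> is compatible with the submodules.\<close>

definition coset_map :: "(('v, 'k) mpoly, 'c) module \<Rightarrow> 'c set \<Rightarrow> ('b \<Rightarrow> 'c) \<Rightarrow> 'b set \<Rightarrow> 'c set" where
  "coset_map M N f A = (\<Union>x\<in>A. N +>\<^bsub>M\<^esub> f x)"

text \<open>\<open>f\<close> has to be additive on \<open>U\<close> but linear only modulo
  \<open>N'\<close>, which admits the exterior derivative, a map that is only a derivation over
  S.\<close>

locale graded_subquotient_hom =
  A: graded_subquotient M G pr I U N + B: graded_subquotient M' G' pr' I U' N'
  for M :: "(('v::finite, 'k::field) mpoly, 'b::ab_group_add) module" and G pr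
    and M' :: "(('v, 'k) mpoly, 'c::ab_group_add) module" and G' pr' I U N U' N' +
  fixes f :: "'b \<Rightarrow> 'c"
  assumes f_U: "x \<in> U \<Longrightarrow> f x \<in> U'" and f_add: "x \<in> U \<Longrightarrow> y \<in> U \<Longrightarrow> f (x + y) = f x + f y"
    and f_N: "x \<in> N \<Longrightarrow> f x \<in> N'"
    and f_smult: "x \<in> U \<Longrightarrow> f (r \<odot>\<^bsub>M\<^esub> x) - r \<odot>\<^bsub>M'\<^esub> f x \<in> N'"
    and f_G: "x \<in> U \<Longrightarrow> x \<in> G d \<Longrightarrow> f x \<in> G' d"
begin

abbreviation "fbar \<equiv> coset_map M' N' f"

lemma fbar_coset:
  assumes x: "x \<in> U"
  shows "fbar (N +>\<^bsub>M\<^esub> x) = N' +>\<^bsub>M'\<^esub> f x"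
proof -
  have eq: "N' +>\<^bsub>M'\<^esub> f y = N' +>\<^bsub>M'\<^esub> f x" if "y - x \<in> N" for y
  proof -
    have "f y = f (y - x) + f x"
      using f_add[of "y - x" x] that A.NU x by auto
    with f_N[OF that] show ?thesis
      by (simp add: B.coset_eq_iff[OF B.hN])
  qed
  have "x \<in> N +>\<^bsub>M\<^esub> x"
    by (simp add: A.mem_coset A.hsub_zero[OF A.hN])
  then have "fbar (N +>\<^bsub>M\<^esub> x) = (\<Union>y\<in>N +>\<^bsub>M\<^esub> x. N' +>\<^bsub>M'\<^esub> f x)"
    unfolding coset_map_def by (intro SUP_cong refl eq) (simp add: A.mem_coset)
  with \<open>x \<in> N +>\<^bsub>M\<^esub> x\<close> show ?thesis
    by blast
qed

lemma graded_hom_fbar: "graded_hom (coord_ring I) A.Q A.QG B.Q B.QG fbar"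
proof -
  have "fbar \<in> LinearCombinations.module_hom (coord_ring I) A.Q B.Q"
    unfolding LinearCombinations.module_hom_def
  proof (intro CollectI conjI allI impI)
    show "fbar \<in> carrier A.Q \<rightarrow> carrier B.Q"
      using f_U by (auto simp: A.carrier_Q B.carrier_Q fbar_coset)
    show "fbar (A \<oplus>\<^bsub>A.Q\<^esub> B) = fbar A \<oplus>\<^bsub>B.Q\<^esub> fbar B"
      if "A \<in> carrier A.Q \<and> B \<in> carrier A.Q" for A B
      using that by (auto simp: A.carrier_Q A.add_Q B.add_Q fbar_coset f_add A.hsub_add[OF A.hU])
    show "fbar (c \<odot>\<^bsub>A.Q\<^esub> A) = c \<odot>\<^bsub>B.Q\<^esub> fbar A"
      if cA: "c \<in> carrier (coord_ring I) \<and> A \<in> carrier A.Q" for c A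
    proof -
      obtain r x where "c = I +>\<^bsub>mpoly_ring\<^esub> r" "A = N +>\<^bsub>M\<^esub> x" "x \<in> U"
        using cA by (auto simp: A.carrier_Q carrier_coord_ring[OF A.I])
      with f_smult[of x r] show ?thesis
        by (simp add: A.smult_Q B.smult_Q fbar_coset f_U A.hsub_smult[OF A.hU] B.coset_eq_iff[OF B.hN])
    qed
  qed
  moreover have "fbar ` A.QG d \<subseteq> B.QG d" for d
    using f_U f_G by (auto simp: subquotient_part_def fbar_coset)
  ultimately show ?thesis
    by (auto simp: graded_hom_def)
qed

end


section \<open>Dimensions\<close>

text \<open>Independent subsets of W remain independent in V, so their size is bounded by the
  dimension of V; one of them is maximal and hence a basis of W.\<close>

lemma (in vectorspace) subspace_fin_dim:
  assumes W: "VectorSpace.subspace K W V" and fd: "fin_dim"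
  shows "vectorspace.fin_dim K (vs W)" and "vectorspace.dim K (vs W) \<le> dim"
proof -
  interpret W: vectorspace K "vs W"
    by (rule subspace_is_vs[OF W])
  have sub: "submodule K W V"
    using W by simp
  have WV: "W \<subseteq> carrier V"
    using sub by (simp add: submodule_def)
  have li: "finite A \<and> card A \<le> dim" if "A \<subseteq> carrier (vs W) \<and> W.lin_indpt A" for A
    using that li_le_dim[OF fd, of A] WV span_li_not_depend(2)[OF _ sub, of A] by auto
  have "W.lin_indpt {}"
    by (simp add: W.lin_dep_def)
  then obtain A where A: "finite A" "maximal A (\<lambda>S. S \<subseteq> carrier (vs W) \<and> W.lin_indpt S)"
    using maximal_exists[of "\<lambda>S. S \<subseteq> carrier (vs W) \<and> W.lin_indpt S" dim "{}"] li by blast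
  have basis: "W.basis A"
    by (rule W.max_li_is_basis[OF A(2)])
  then show "W.fin_dim"
    using A(1) unfolding W.fin_dim_def W.basis_def by blast
  have "W.dim = card A"
    by (rule W.dim_basis[OF A(1) basis])
  also have "\<dots> \<le> dim"
    using li[of A] basis unfolding W.basis_def by blast
  finally show "W.dim \<le> dim" .
qed

lemma linear_mapI:
  assumes "vectorspace K V" "vectorspace K W" "f \<in> LinearCombinations.module_hom K V W"
  shows "linear_map K V W f"
  using assms by (auto simp: linear_map_def mod_hom_def mod_hom_axioms_def vectorspace_def)

lemma rank_nullity_surj:
  assumes "linear_map K V W f" and "vectorspace.fin_dim K V" and "f ` carrier V = carrier W"
  shows "vectorspace.dim K W + vectorspace.dim K (V\<lparr>carrier := {v \<in> carrier V. f v = \<zero>\<^bsub>W\<^esub>}\<rparr>) = vectorspace.dim K V"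
proof -
  interpret linear_map K V W f by fact
  have "imT = carrier W"
    using assms(3) by (simp add: im_def)
  with rank_nullity[OF assms(2)] show ?thesis
    by (simp add: ker_def)
qed

text \<open>dim V3 - dim V4 = dim ker c <= dim im b = dim V2 - dim ker b <= dim V2 - dim im a, and
  dim im a = dim V1. The sums on both sides avoid subtraction of natural numbers.\<close>

lemma dim_complex:
  assumes a: "linear_map K V1 V2 a" and b: "linear_map K V2 V3 b" and c: "linear_map K V3 V4 c"
    and fd: "vectorspace.fin_dim K V1" "vectorspace.fin_dim K V2" "vectorspace.fin_dim K V3"
    and inj: "inj_on a (carrier V1)" and ba: "\<And>x. x \<in> carrier V1 \<Longrightarrow> b (a x) = \<zero>\<^bsub>V3\<^esub>"
    and exact: "\<And>y. y \<in> carrier V3 \<Longrightarrow> c y = \<zero>\<^bsub>V4\<^esub> \<Longrightarrow> y \<in> b ` carrier V2"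
    and surj: "c ` carrier V3 = carrier V4"
  shows "vectorspace.dim K V3 + vectorspace.dim K V1 \<le> vectorspace.dim K V4 + vectorspace.dim K V2"
proof -
  interpret V2: vectorspace K V2 using b by (simp add: linear_map_def)
  interpret V3: vectorspace K V3 using b by (simp add: linear_map_def)
  interpret a: linear_map K V1 V2 a by fact
  interpret b: linear_map K V2 V3 b by fact
  interpret c: linear_map K V3 V4 c by fact
  have kb: "vectorspace K (V2\<lparr>carrier := b.kerT\<rparr>)" and ib: "vectorspace K (V3\<lparr>carrier := b.imT\<rparr>)"
    using V2.subspace_is_vs[OF b.kerT_is_subspace] V3.subspace_is_vs[OF b.imT_is_subspace] by auto
  have "a.imT \<subseteq> b.kerT"
    using ba by (auto simp: a.im_def b.ker_def)
  then have "VectorSpace.subspace K a.imT (V2\<lparr>carrier := b.kerT\<rparr>)"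
    using a.imT_is_subspace kb by (auto simp: VectorSpace.subspace_def submodule_def vectorspace_def)
  from vectorspace.subspace_fin_dim(2)[OF kb this] V2.subspace_fin_dim(1)[OF b.kerT_is_subspace fd(2)]
  have 1: "vectorspace.dim K (V2\<lparr>carrier := a.imT\<rparr>) \<le> vectorspace.dim K (V2\<lparr>carrier := b.kerT\<rparr>)"
    by simp
  have 2: "vectorspace.dim K (V2\<lparr>carrier := a.imT\<rparr>) = vectorspace.dim K V1"
    using a.rank_nullity[OF fd(1)] a.inj_imp_dim_ker0[OF inj] by simp
  have 3: "vectorspace.dim K (V3\<lparr>carrier := b.imT\<rparr>) + vectorspace.dim K (V2\<lparr>carrier := b.kerT\<rparr>)
      = vectorspace.dim K V2"
    by (rule b.rank_nullity[OF fd(2)])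
  have "c.kerT \<subseteq> b.imT"
    using exact by (auto simp: c.ker_def b.im_def)
  then have "VectorSpace.subspace K c.kerT (V3\<lparr>carrier := b.imT\<rparr>)"
    using c.kerT_is_subspace ib by (auto simp: VectorSpace.subspace_def submodule_def vectorspace_def)
  from vectorspace.subspace_fin_dim(2)[OF ib this] V3.subspace_fin_dim(1)[OF b.imT_is_subspace fd(3)]
  have 4: "vectorspace.dim K (V3\<lparr>carrier := c.kerT\<rparr>) \<le> vectorspace.dim K (V3\<lparr>carrier := b.imT\<rparr>)"
    by simp
  have 5: "vectorspace.dim K V4 + vectorspace.dim K (V3\<lparr>carrier := c.kerT\<rparr>) = vectorspace.dim K V3"
    using rank_nullity_surj[OF c fd(3) surj] by (simp add: c.ker_def)
  from 1 2 3 4 5 show ?thesis by simp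
qed

section \<open>Graded parts as vector spaces over K\<close>

definition kvec :: "(('v, 'k::field) mpoly, 'b) module \<Rightarrow> 'b set \<Rightarrow> ('k, 'b) module" where
  "kvec M A = \<lparr>carrier = A, mult = undefined, one = undefined, zero = \<zero>\<^bsub>M\<^esub>, add = add M,
     smult = (\<lambda>c x. const_poly c \<odot>\<^bsub>M\<^esub> x)\<rparr>"

abbreviation kdim :: "(('v, 'k::field) mpoly, 'b) module \<Rightarrow> 'b set \<Rightarrow> nat" where
  "kdim M A \<equiv> vectorspace.dim (ring_of_type_algebra :: 'k ring) (kvec M A)"

abbreviation kfin_dim :: "(('v, 'k::field) mpoly, 'b) module \<Rightarrow> 'b set \<Rightarrow> bool" where
  "kfin_dim M A \<equiv> vectorspace.fin_dim (ring_of_type_algebra :: 'k ring) (kvec M A)"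

definition hvec :: "('v, 'k::field) mpoly set \<Rightarrow> (('v, 'k) mpoly set, 'b) module \<Rightarrow> 'b set \<Rightarrow> ('k, 'b) module" where
  "hvec I Q A = \<lparr>carrier = A, mult = undefined, one = undefined, zero = \<zero>\<^bsub>Q\<^esub>, add = add Q,
      smult = (\<lambda>c x. (I +>\<^bsub>mpoly_ring\<^esub> const_poly c) \<odot>\<^bsub>Q\<^esub> x)\<rparr>"

lemma hilbert_function_hvec:
  fixes I :: "('v, 'k::field) mpoly set"
  shows "hilbert_function I Q G d = vectorspace.dim (ring_of_type_algebra :: 'k ring) (hvec I Q (G d))"
  by (simp add: hilbert_function_def hvec_def)

context graded_forms
begin

text \<open>Graded parts are not S-submodules; closure under constants is all that a K-subspace
  requires.\<close>

definition ksub :: "'b set \<Rightarrow> bool" where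
  "ksub A \<longleftrightarrow> 0 \<in> A \<and> (\<forall>x\<in>A. \<forall>y\<in>A. x + y \<in> A) \<and> (\<forall>c. \<forall>x\<in>A. const_poly c \<odot>\<^bsub>M\<^esub> x \<in> A)"

lemma const_smult_pr: "x \<in> G d \<Longrightarrow> const_poly c \<odot>\<^bsub>M\<^esub> x \<in> G d"
  using smult_G[OF const_poly_in_poly_part] by force

lemma ksub_hsub: "hsub U \<Longrightarrow> ksub (U \<inter> G d)"
  unfolding ksub_def using const_smult_pr
  by (auto simp: hsub_zero hsub_add hsub_smult) (auto simp: G_iff carrier_zero carrier_add pr_add)

lemma vectorspace_kvec:
  assumes "ksub A"
  shows "vectorspace (ring_of_type_algebra :: 'k ring) (kvec M A)"
proof (rule vs_criteria[OF field_from_type_algebra])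
  show "\<forall>x\<in>carrier (kvec M A). \<exists>y\<in>carrier (kvec M A). x \<oplus>\<^bsub>kvec M A\<^esub> y = \<zero>\<^bsub>kvec M A\<^esub>"
  proof
    fix x assume x: "x \<in> carrier (kvec M A)"
    then have "const_poly (- 1) \<odot>\<^bsub>M\<^esub> x \<in> A"
      using assms by (simp add: kvec_def ksub_def)
    moreover have "const_poly (- 1) = (- 1 :: ('v, 'k) mpoly)"
      by (simp add: const_poly_def single_uminus)
    ultimately show "\<exists>y\<in>carrier (kvec M A). x \<oplus>\<^bsub>kvec M A\<^esub> y = \<zero>\<^bsub>kvec M A\<^esub>"
      by (intro bexI[of _ "- x"]) (simp_all add: kvec_def smult_minus_one)
  qed
qed (use assms in \<open>auto simp: kvec_def ksub_def const_poly_add const_poly_mult const_poly_one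
    smult_add_left smult_add_right smult_assoc add_ac\<close>)

lemma subspace_kvec:
  assumes "ksub A" "ksub B" "B \<subseteq> A"
  shows "VectorSpace.subspace (ring_of_type_algebra :: 'k ring) B (kvec M A)"
  using assms vectorspace_kvec[OF assms(1)]
  by (auto simp: VectorSpace.subspace_def submodule_def vectorspace_def) (auto simp: kvec_def ksub_def)

lemma kvec_update: "kvec M A\<lparr>carrier := B\<rparr> = kvec M B"
  by (simp add: kvec_def)

lemma kfin_dim_mono:
  assumes "ksub A" "ksub B" "B \<subseteq> A" "kfin_dim M A"
  shows "kfin_dim M B"
  using vectorspace.subspace_fin_dim(1)[OF vectorspace_kvec[OF assms(1)] subspace_kvec[OF assms(1-3)] assms(4)]
  by (simp add: kvec_update)

lemma kfin_dimI:
  assumes A: "ksub A" and J: "finite J" and g: "\<And>j. j \<in> J \<Longrightarrow> g j \<in> A"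
    and c: "\<And>x. x \<in> A \<Longrightarrow> x = (\<Sum>j\<in>J. const_poly (c x j) \<odot>\<^bsub>M\<^esub> g j)"
  shows "kfin_dim M A"
proof -
  interpret vectorspace "ring_of_type_algebra :: 'k ring" "kvec M A"
    by (rule vectorspace_kvec[OF A])
  have gA: "g ` J \<subseteq> carrier (kvec M A)"
    using g by (auto simp: kvec_def)
  have sm: "submodule (ring_of_type_algebra :: 'k ring) (span (g ` J)) (kvec M A)"
    by (rule span_is_submodule[OF gA])
  have "(\<Sum>j\<in>J'. const_poly (e j) \<odot>\<^bsub>M\<^esub> g j) \<in> span (g ` J)" if "J' \<subseteq> J" for J' e
    using finite_subset[OF that J] that
  proof (induction J' rule: finite_induct)
    case empty
    then show ?case
      using submodule.zero_closed[OF sm] by (simp add: kvec_def)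
  next
    case (insert j J')
    have "const_poly (e j) \<odot>\<^bsub>M\<^esub> g j \<in> span (g ` J)"
      using submodule.smult_closed[OF sm, of "e j" "g j"] in_own_span[OF gA] insert
      by (auto simp: kvec_def)
    then show ?case
      using insert submodule.m_closed[OF sm, of "const_poly (e j) \<odot>\<^bsub>M\<^esub> g j"] by (simp add: kvec_def)
  qed
  from this[OF order_refl] c have "A \<subseteq> span (g ` J)"
    by (metis subsetI)
  moreover have "span (g ` J) \<subseteq> A"
    using span_is_subset2[OF gA] by (simp add: kvec_def)
  ultimately have "gen_set (g ` J)"
    by (simp add: kvec_def)
  then show ?thesis
    using gA J unfolding fin_dim_def by blast
qed

end

context graded_subquotient
begin

lemma vectorspace_hvec: "vectorspace (ring_of_type_algebra :: 'k ring) (hvec I Q (QG d))"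
proof -
  interpret Q: abelian_group Q by (rule abelian_group_Q)
  have QG: "QG d \<subseteq> carrier Q"
    by (auto simp: subquotient_part_def carrier_Q)
  have grp: "x \<oplus>\<^bsub>Q\<^esub> y \<in> QG d" "\<ominus>\<^bsub>Q\<^esub> x \<in> QG d" "\<zero>\<^bsub>Q\<^esub> \<in> QG d" if "x \<in> QG d" "y \<in> QG d" for x y
    using subgroup.m_closed[OF subgroup_QG[of d]] subgroup.m_inv_closed[OF subgroup_QG[of d]]
      subgroup.one_closed[OF subgroup_QG[of d]] that by (auto simp: a_inv_def)
  have zero: "\<zero>\<^bsub>Q\<^esub> \<in> QG d"
    using subgroup.one_closed[OF subgroup_QG[of d]] by simp
  show ?thesis
  proof (rule vs_criteria[OF field_from_type_algebra])
    show "\<forall>x\<in>carrier (hvec I Q (QG d)). \<exists>y\<in>carrier (hvec I Q (QG d)).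
        x \<oplus>\<^bsub>hvec I Q (QG d)\<^esub> y = \<zero>\<^bsub>hvec I Q (QG d)\<^esub>"
    proof
      fix x assume "x \<in> carrier (hvec I Q (QG d))"
      then have "x \<in> QG d" by (simp add: hvec_def)
      then show "\<exists>y\<in>carrier (hvec I Q (QG d)). x \<oplus>\<^bsub>hvec I Q (QG d)\<^esub> y = \<zero>\<^bsub>hvec I Q (QG d)\<^esub>"
        using grp Q.r_neg QG by (intro bexI[of _ "\<ominus>\<^bsub>Q\<^esub> x"]) (auto simp: hvec_def)
    qed
    show "\<forall>c x. c \<in> carrier (ring_of_type_algebra :: 'k ring) \<and> x \<in> carrier (hvec I Q (QG d)) \<longrightarrow>
        c \<odot>\<^bsub>hvec I Q (QG d)\<^esub> x \<in> carrier (hvec I Q (QG d))"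
    proof clarify
      fix c x assume "x \<in> carrier (hvec I Q (QG d))"
      then obtain y where "x = N +>\<^bsub>M\<^esub> y" "y \<in> U" "y \<in> G d"
        by (auto simp: hvec_def subquotient_part_def)
      then show "c \<odot>\<^bsub>hvec I Q (QG d)\<^esub> x \<in> carrier (hvec I Q (QG d))"
        using const_smult_pr[of y d c] hsub_smult[OF hU]
        by (auto simp: hvec_def subquotient_part_def smult_Q intro!: exI[of _ "const_poly c \<odot>\<^bsub>M\<^esub> y"])
    qed
  next
    show "\<forall>a b v. a \<in> carrier (ring_of_type_algebra :: 'k ring) \<and>
        b \<in> carrier (ring_of_type_algebra :: 'k ring) \<and> v \<in> carrier (hvec I Q (QG d)) \<longrightarrow>
        (a \<otimes>\<^bsub>ring_of_type_algebra\<^esub> b) \<odot>\<^bsub>hvec I Q (QG d)\<^esub> v =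
        a \<odot>\<^bsub>hvec I Q (QG d)\<^esub> (b \<odot>\<^bsub>hvec I Q (QG d)\<^esub> v)"
      by (auto simp: hvec_def subquotient_part_def smult_Q hsub_smult[OF hU] const_poly_mult smult_assoc)
    show "\<forall>v\<in>carrier (hvec I Q (QG d)). \<one>\<^bsub>ring_of_type_algebra :: 'k ring\<^esub> \<odot>\<^bsub>hvec I Q (QG d)\<^esub> v = v"
      by (auto simp: hvec_def subquotient_part_def smult_Q const_poly_one)
    show "\<forall>a b v. a \<in> carrier (ring_of_type_algebra :: 'k ring) \<and>
        b \<in> carrier (ring_of_type_algebra :: 'k ring) \<and> v \<in> carrier (hvec I Q (QG d)) \<longrightarrow>
        (a \<oplus>\<^bsub>ring_of_type_algebra\<^esub> b) \<odot>\<^bsub>hvec I Q (QG d)\<^esub> v =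
        a \<odot>\<^bsub>hvec I Q (QG d)\<^esub> v \<oplus>\<^bsub>hvec I Q (QG d)\<^esub> b \<odot>\<^bsub>hvec I Q (QG d)\<^esub> v"
      by (auto simp: hvec_def subquotient_part_def smult_Q add_Q const_poly_add smult_add_left)
    show "\<forall>a v w. a \<in> carrier (ring_of_type_algebra :: 'k ring) \<and>
        v \<in> carrier (hvec I Q (QG d)) \<and> w \<in> carrier (hvec I Q (QG d)) \<longrightarrow>
        a \<odot>\<^bsub>hvec I Q (QG d)\<^esub> (v \<oplus>\<^bsub>hvec I Q (QG d)\<^esub> w) =
        a \<odot>\<^bsub>hvec I Q (QG d)\<^esub> v \<oplus>\<^bsub>hvec I Q (QG d)\<^esub> a \<odot>\<^bsub>hvec I Q (QG d)\<^esub> w"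
      by (auto simp: hvec_def subquotient_part_def smult_Q add_Q smult_add_right hsub_add[OF hU])
    show "\<forall>v w. v \<in> carrier (hvec I Q (QG d)) \<and> w \<in> carrier (hvec I Q (QG d)) \<longrightarrow>
        v \<oplus>\<^bsub>hvec I Q (QG d)\<^esub> w = w \<oplus>\<^bsub>hvec I Q (QG d)\<^esub> v"
      using QG Q.a_comm by (simp add: hvec_def subset_iff)
  qed (use grp zero QG in \<open>auto simp: hvec_def Q.a_assoc subset_iff\<close>)
qed

lemma linear_map_projection:
  "linear_map (ring_of_type_algebra :: 'k ring) (kvec M (U \<inter> G d)) (hvec I Q (QG d)) (\<lambda>x. N +>\<^bsub>M\<^esub> x)"
proof (rule linear_mapI[OF vectorspace_kvec[OF ksub_hsub[OF hU]] vectorspace_hvec])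
  show "(\<lambda>x. N +>\<^bsub>M\<^esub> x) \<in> LinearCombinations.module_hom (ring_of_type_algebra :: 'k ring)
      (kvec M (U \<inter> G d)) (hvec I Q (QG d))"
    unfolding LinearCombinations.module_hom_def
    by (auto simp: kvec_def hvec_def subquotient_part_def add_Q smult_Q)
qed

text \<open>Rank-nullity for the projection from the degree d part of U onto that of U/N, whose
  kernel is the degree d part of N.\<close>

lemma hilbert_function_Q:
  assumes fd: "kfin_dim M (U \<inter> G d)"
  shows "vectorspace.fin_dim (ring_of_type_algebra :: 'k ring) (hvec I Q (QG d))"
    and "hilbert_function I Q QG d + kdim M (N \<inter> G d) = kdim M (U \<inter> G d)"
proof -
  have surj: "(\<lambda>x. N +>\<^bsub>M\<^esub> x) ` carrier (kvec M (U \<inter> G d)) = carrier (hvec I Q (QG d))"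
    by (auto simp: kvec_def hvec_def subquotient_part_def)
  show "vectorspace.fin_dim (ring_of_type_algebra :: 'k ring) (hvec I Q (QG d))"
    by (rule linear_map.surj_fin_dim[OF linear_map_projection fd surj])
  have ker: "{v \<in> carrier (kvec M (U \<inter> G d)). N +>\<^bsub>M\<^esub> v = \<zero>\<^bsub>hvec I Q (QG d)\<^esub>} = N \<inter> G d"
    using NU by (auto simp: kvec_def hvec_def zero_Q coset_eq_zero_iff[OF hN])
  show "hilbert_function I Q QG d + kdim M (N \<inter> G d) = kdim M (U \<inter> G d)"
    using rank_nullity_surj[OF linear_map_projection fd surj]
    by (simp add: hilbert_function_hvec ker kvec_update)
qed

end

text \<open>Scalars of K act through cosets of constant polynomials, so linearity over S/I contains
  linearity over K.\<close>

lemma linear_map_hvec: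
  fixes I :: "('v, 'k::field) mpoly set"
  assumes f: "graded_hom (coord_ring I) Q G Q' G' f"
    and I: "ideal I mpoly_ring" and G: "G d \<subseteq> carrier Q"
    and vs: "vectorspace (ring_of_type_algebra :: 'k ring) (hvec I Q (G d))"
      "vectorspace (ring_of_type_algebra :: 'k ring) (hvec I Q' (G' d))"
  shows "linear_map (ring_of_type_algebra :: 'k ring) (hvec I Q (G d)) (hvec I Q' (G' d)) f"
proof (rule linear_mapI[OF vs])
  show "f \<in> LinearCombinations.module_hom (ring_of_type_algebra :: 'k ring) (hvec I Q (G d)) (hvec I Q' (G' d))"
  proof -
    have "I +>\<^bsub>mpoly_ring\<^esub> const_poly c \<in> carrier (coord_ring I)" for c
      by (auto simp: carrier_coord_ring[OF I])
    then show ?thesis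
      using f G unfolding graded_hom_def LinearCombinations.module_hom_def
      by (auto simp: hvec_def subset_iff image_subset_iff)
  qed
qed

section \<open>Hilbert functions of coordinate rings\<close>

lemma finite_mon_degree: "finite {e :: 'v::finite \<Rightarrow>\<^sub>0 nat. mon_degree e = d}"
proof -
  have "Poly_Mapping.lookup ` {e :: 'v \<Rightarrow>\<^sub>0 nat. mon_degree e = d} \<subseteq> UNIV \<rightarrow>\<^sub>E {..d}"
    by (auto simp: mon_degree_def PiE_UNIV_domain intro: member_le_sum)
  moreover have "finite ((UNIV :: 'v set) \<rightarrow>\<^sub>E {..d})"
    by (intro finite_PiE) auto
  ultimately have "finite (Poly_Mapping.lookup ` {e :: 'v \<Rightarrow>\<^sub>0 nat. mon_degree e = d})"
    by (rule finite_subset)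
  then show ?thesis
    by (rule finite_imageD) (simp add: inj_on_def)
qed

lemma sum_monomials:
  assumes "F \<in> poly_part d"
  shows "(\<Sum>e | mon_degree e = d. const_poly (Poly_Mapping.lookup F e) * Poly_Mapping.single e 1) = F"
proof -
  have "(\<Sum>e | mon_degree e = d. const_poly (Poly_Mapping.lookup F e) * Poly_Mapping.single e 1) =
      (\<Sum>e | mon_degree e = d. Poly_Mapping.single e (Poly_Mapping.lookup F e))"
    by (simp add: const_poly_def mult_single)
  also have "\<dots> = (\<Sum>e\<in>Poly_Mapping.keys F. Poly_Mapping.single e (Poly_Mapping.lookup F e))"
    by (rule sum.mono_neutral_right)
      (use assms in \<open>auto simp: finite_mon_degree homog_shift_def not_in_keys_iff_lookup_eq_zero\<close>)
  finally show ?thesis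
    by (simp flip: sum_singles)
qed

lemma hsub_UNIV: "polys.hsub UNIV"
  by (simp add: polys.hsub_def)

lemma kfin_dim_poly_part: "kfin_dim (regular_module mpoly_ring) (poly_part d)"
proof (rule polys.kfin_dimI[where c = Poly_Mapping.lookup])
  show "polys.ksub (poly_part d)"
    using polys.ksub_hsub[OF hsub_UNIV] by simp
  show "finite {e. mon_degree e = d}"
    by (rule finite_mon_degree)
  show "Poly_Mapping.single e 1 \<in> poly_part d" if "e \<in> {e. mon_degree e = d}" for e
    using that by (simp add: single_in_homog_shift)
qed (simp add: sum_monomials)

lemma regular_module_sel:
  "smult (regular_module R) = mult R" "zero (regular_module R) = zero R" "add (regular_module R) = add R"
  by (simp_all add: regular_module_def ring.defs module.defs)

lemma HF_scheme_eq:
  fixes I :: "('v::finite, 'k::field) mpoly set"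
  assumes hI: "homog_ideal I"
  shows "HF_scheme I d + kdim (regular_module mpoly_ring) (I \<inter> poly_part d) =
    kdim (regular_module mpoly_ring) (poly_part d :: ('v, 'k) mpoly set)"
proof -
  have I: "ideal I mpoly_ring"
    using hI by (simp add: homog_ideal_def)
  interpret graded_subquotient "regular_module mpoly_ring" poly_part "hcomp 0" I UNIV I
    by (rule graded_subquotient_polys)
      (use hI I in \<open>auto simp: homog_ideal_def ideal_iff ideal_mult_right\<close>)
  \<comment> \<open>S/I as a subquotient of the regular module of S and as a module over itself
    yield the same K-space in every degree.\<close>
  have "hvec I Q (QG d) = hvec I (regular_module (coord_ring I)) (coord_ring_part I d)"
    by (simp add: hvec_def regular_module_sel subquotient_def subquotient_part_def coord_ring_part_def
        coset_regular FactRing_def rcoset_mult_def set_add_def' fun_eq_iff)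
  then show ?thesis
    using hilbert_function_Q(2)[of d] kfin_dim_poly_part[of d]
    by (simp add: HF_scheme_def hilbert_function_hvec)
qed


section \<open>Differential forms\<close>

text \<open>The free module on A, as functions vanishing outside A: \<open>UNIV\<close> gives
  Omega^1 and \<open>upper\<close> gives Omega^2, so both are covered by one instance of the
  locale.\<close>

definition forms :: "'p set \<Rightarrow> (('v, 'k::comm_ring_1) mpoly, 'p \<Rightarrow> ('v, 'k) mpoly) module" where
  "forms A = \<lparr>carrier = {\<omega>. \<forall>p. p \<notin> A \<longrightarrow> \<omega> p = 0}, mult = undefined, one = undefined, zero = (\<lambda>_. 0),
     add = (\<lambda>\<omega> \<eta> p. \<omega> p + \<eta> p), smult = (\<lambda>F \<omega> p. F * \<omega> p)\<rparr>"

definition form_comp :: "nat \<Rightarrow> nat \<Rightarrow> ('p \<Rightarrow> ('v::finite, 'k::comm_ring_1) mpoly) \<Rightarrow> 'p \<Rightarrow> ('v, 'k) mpoly" where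
  "form_comp k d \<omega> = (\<lambda>p. hcomp k d (\<omega> p))"

definition forms_part :: "'p set \<Rightarrow> nat \<Rightarrow> nat \<Rightarrow> ('p \<Rightarrow> ('v::finite, 'k::comm_ring_1) mpoly) set" where
  "forms_part A k d = {\<omega>. (\<forall>p. p \<notin> A \<longrightarrow> \<omega> p = 0) \<and> (\<forall>p. \<omega> p \<in> homog_shift k d)}"

lemma graded_forms_forms:
  "graded_forms (forms A :: (('v::finite, 'k::field) mpoly, 'p::finite \<Rightarrow> _) module)
    (forms_part A k) (form_comp k)"
proof
  fix \<omega> :: "'p \<Rightarrow> ('v, 'k) mpoly"
  have sub: "{d. form_comp k d \<omega> \<noteq> 0} = (\<Union>p. {d. hcomp k d (\<omega> p) \<noteq> 0})"
    by (auto simp: form_comp_def fun_eq_iff)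
  show fin: "finite {d. form_comp k d \<omega> \<noteq> 0}"
    unfolding sub by (intro finite_UN_I finite_hcomp_support) simp
  have "(\<Sum>d\<in>D. form_comp k d \<omega>) p = (\<Sum>d\<in>D. hcomp k d (\<omega> p))" for D p
    by (induction D rule: infinite_finite_induct) (simp_all add: form_comp_def)
  then show "(\<Sum>d | form_comp k d \<omega> \<noteq> 0. form_comp k d \<omega>) = \<omega>"
    by (intro ext) (use fin in \<open>auto intro!: sum_hcomp simp: sub\<close>)
qed (auto simp: forms_def form_comp_def forms_part_def fun_eq_iff algebra_simps hcomp_add hcomp_hcomp
    homog_shift_iff intro: homog_shift_mult[unfolded homog_shift_iff])

definition pointwise :: "'p set \<Rightarrow> ('v, 'k::comm_ring_1) mpoly set \<Rightarrow> ('p \<Rightarrow> ('v, 'k) mpoly) set" where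
  "pointwise A V = {\<omega>. (\<forall>p\<in>A. \<omega> p \<in> V) \<and> (\<forall>p. p \<notin> A \<longrightarrow> \<omega> p = 0)}"

text \<open>Induction on A: evaluation at a new index p maps onto V, and its kernel consists of the
  families supported on the old indices. The vector operations are the same for every B, so B stays
  fixed while A grows.\<close>

lemma kdim_pointwise:
  fixes V :: "('v::finite, 'k::field) mpoly set" and A :: "'p::finite set"
  assumes V: "polys.ksub V" and Vd: "V \<subseteq> poly_part d"
  shows "kfin_dim (forms B) (pointwise A V)"
    and "kdim (forms B) (pointwise A V) = card A * kdim (regular_module mpoly_ring) V"
proof -
  interpret F: graded_forms "forms B :: (('v, 'k) mpoly, 'p \<Rightarrow> _) module" "forms_part B 0" "form_comp 0"
    by (rule graded_forms_forms)
  have forms_smult: "F \<odot>\<^bsub>forms B\<^esub> \<omega> = (\<lambda>p. F * \<omega> p)" for F :: "('v, 'k) mpoly" and \<omega> :: "'p \<Rightarrow> _"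
    by (simp add: forms_def)
  have ksub: "F.ksub (pointwise A W)" if "polys.ksub W" for A and W :: "('v, 'k) mpoly set"
    using that by (auto simp: F.ksub_def polys.ksub_def pointwise_def forms_smult)
  have fin: "kfin_dim (forms B) (pointwise A V)" for A
  proof (rule F.kfin_dim_mono)
    show ks: "F.ksub (pointwise A (poly_part d))"
      using polys.ksub_hsub[OF hsub_UNIV] by (intro ksub) simp
    show "F.ksub (pointwise A V)"
      by (rule ksub[OF V])
    show "pointwise A V \<subseteq> pointwise A (poly_part d)"
      using Vd by (auto simp: pointwise_def)
    show "kfin_dim (forms B) (pointwise A (poly_part d :: ('v, 'k) mpoly set))"
    proof (rule F.kfin_dimI[OF ks])
      show "finite (A \<times> {e :: 'v \<Rightarrow>\<^sub>0 nat. mon_degree e = d})"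
        by (intro finite_cartesian_product finite_mon_degree) simp
      \<comment> \<open>The family with the monomial \<open>e\<close> at position \<open>p\<close>
        and 0 elsewhere; these span the forms whose coefficients have degree
        \<open>d\<close>.\<close>
      define g :: "'p \<times> ('v \<Rightarrow>\<^sub>0 nat) \<Rightarrow> 'p \<Rightarrow> ('v, 'k) mpoly"
        where "g = (\<lambda>(p, e) q. if q = p then Poly_Mapping.single e 1 else 0)"
      show "g j \<in> pointwise A (poly_part d)" if "j \<in> A \<times> {e. mon_degree e = d}" for j
        using that by (auto simp: g_def pointwise_def homog_shift_def split: if_splits)
      show "\<omega> = (\<Sum>j\<in>A \<times> {e. mon_degree e = d}.
          const_poly ((\<lambda>\<omega> (p, e). Poly_Mapping.lookup (\<omega> p) e) \<omega> j) \<odot>\<^bsub>forms B\<^esub> g j)"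
        if \<omega>: "\<omega> \<in> pointwise A (poly_part d)" for \<omega>
      proof
        fix q
        have app: "(\<Sum>j\<in>J. f j) q = (\<Sum>j\<in>J. f j q)" for J and f :: "'p \<times> ('v \<Rightarrow>\<^sub>0 nat) \<Rightarrow> 'p \<Rightarrow> ('v, 'k) mpoly"
          by (induction J rule: infinite_finite_induct) auto
        have "(\<Sum>j\<in>A \<times> {e. mon_degree e = d}.
            const_poly ((\<lambda>\<omega> (p, e). Poly_Mapping.lookup (\<omega> p) e) \<omega> j) \<odot>\<^bsub>forms B\<^esub> g j) q =
            (\<Sum>p\<in>A. \<Sum>e | mon_degree e = d. const_poly (Poly_Mapping.lookup (\<omega> p) e) *
              (if q = p then Poly_Mapping.single e 1 else 0))"
          unfolding app forms_smult sum.cartesian_product by (intro sum.cong) (auto simp: g_def)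
        also have "\<dots> = (\<Sum>p\<in>A. if q = p then \<omega> p else 0)"
          using \<omega> by (intro sum.cong) (auto simp: pointwise_def sum_monomials)
        also have "\<dots> = \<omega> q"
          using \<omega> by (auto simp: pointwise_def)
        finally show "\<omega> q = (\<Sum>j\<in>A \<times> {e. mon_degree e = d}.
            const_poly ((\<lambda>\<omega> (p, e). Poly_Mapping.lookup (\<omega> p) e) \<omega> j) \<odot>\<^bsub>forms B\<^esub> g j) q"
          by simp
      qed
    qed
  qed
  then show "kfin_dim (forms B) (pointwise A V)" .
  have "finite A" by simp
  then show "kdim (forms B) (pointwise A V) = card A * kdim (regular_module mpoly_ring) V"
  proof (induction A rule: finite_induct)
    case empty
    interpret vectorspace "ring_of_type_algebra :: 'k ring" "kvec (forms B) (pointwise {} V)"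
      by (rule F.vectorspace_kvec[OF ksub[OF V]])
    have "carrier (kvec (forms B) (pointwise {} V)) = {0}"
      by (auto simp: kvec_def pointwise_def)
    then have "gen_set {\<zero>\<^bsub>kvec (forms B) (pointwise {} V)\<^esub>}"
      using span_is_subset2[of "{\<zero>\<^bsub>kvec (forms B) (pointwise {} V)\<^esub>}"] span_zero by fastforce
    then show ?case
      using dim0I by simp
  next
    case (insert p A)
    have "linear_map (ring_of_type_algebra :: 'k ring) (kvec (forms B) (pointwise (insert p A) V))
        (kvec (regular_module mpoly_ring) V) (\<lambda>\<omega>. \<omega> p)"
      by (rule linear_mapI[OF F.vectorspace_kvec[OF ksub[OF V]] polys.vectorspace_kvec[OF V]])
        (auto simp: LinearCombinations.module_hom_def kvec_def pointwise_def forms_smult)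
    moreover have "(\<lambda>\<omega>. \<omega> p) ` carrier (kvec (forms B) (pointwise (insert p A) V)) =
        carrier (kvec (regular_module mpoly_ring) V)"
    proof -
      have "F \<in> (\<lambda>\<omega>. \<omega> p) ` pointwise (insert p A) V" if "F \<in> V" for F
        using that V by (intro image_eqI[of _ _ "\<lambda>q. if q = p then F else 0"])
          (auto simp: pointwise_def polys.ksub_def)
      then show ?thesis
        by (auto simp: kvec_def) (auto simp: pointwise_def)
    qed
    moreover have "{\<omega> \<in> carrier (kvec (forms B) (pointwise (insert p A) V)).
        \<omega> p = \<zero>\<^bsub>kvec (regular_module mpoly_ring) V\<^esub>} = pointwise A V"
      using \<open>p \<notin> A\<close> V by (auto simp: kvec_def pointwise_def polys.ksub_def)
    ultimately show ?case
      using rank_nullity_surj[of ring_of_type_algebra "kvec (forms B) (pointwise (insert p A) V)"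
          "kvec (regular_module mpoly_ring) V" "\<lambda>\<omega>. \<omega> p"] fin insert
      by (simp add: F.kvec_update)
  qed
qed


abbreviation upper :: "('v::linorder \<times> 'v) set" where
  "upper \<equiv> {(i, j). i < j}"

lemma Omega1_eq: "Omega1 = forms UNIV"
  by (simp add: Omega1_def forms_def)

lemma Omega2_eq: "Omega2 = forms upper"
  by (simp add: Omega2_def forms_def)

lemma form1_part_eq: "form1_part = forms_part UNIV 1"
  by (simp add: fun_eq_iff form1_part_def forms_part_def)

lemma form2_part_eq: "form2_part = forms_part upper 2"
  by (auto simp: fun_eq_iff form2_part_def forms_part_def Omega2_def)

lemma carrier_forms: "carrier (forms A) = pointwise A UNIV"
  and smult_forms: "F \<odot>\<^bsub>forms A\<^esub> \<omega> = (\<lambda>p. F * \<omega> p)"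
  by (simp_all add: forms_def pointwise_def)

text \<open>The shifted component is the ordinary component of degree \<open>d - k\<close>, or 0 if
  \<open>d < k\<close>.\<close>

lemma hcomp_in_homog_ideal:
  assumes "homog_ideal I" and "F \<in> I"
  shows "hcomp k d F \<in> I"
proof -
  have "hcomp k d F = (if k \<le> d then hcomp 0 (d - k) F else 0)"
    by (rule poly_mapping_eqI) (auto simp: lookup_hcomp when_def)
  with assms show ?thesis
    by (simp add: homog_ideal_def ideal_iff)
qed

lemma hsub_pointwise:
  fixes I :: "('v::finite, 'k::field) mpoly set" and A :: "'p::finite set"
  assumes "homog_ideal I"
  shows "graded_forms.hsub (forms A) (form_comp k) (pointwise A I)"
proof -
  interpret graded_forms "forms A :: (('v, 'k) mpoly, 'p \<Rightarrow> _) module" "forms_part A k" "form_comp k"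
    by (rule graded_forms_forms)
  have "ideal I mpoly_ring"
    using assms by (simp add: homog_ideal_def)
  with assms show ?thesis
    by (auto simp: hsub_def carrier_forms smult_forms pointwise_def form_comp_def
        ideal_zero ideal_add ideal_mult_left hcomp_in_homog_ideal)
qed

lemma pointwise_inter_part:
  "0 \<in> V \<Longrightarrow> pointwise A V \<inter> forms_part A k (e + k) = pointwise A (V \<inter> poly_part e)"
  by (auto simp: pointwise_def forms_part_def homog_shift_def)

lemma (in graded_forms) submodule_hsub: "hsub H \<Longrightarrow> submodule mpoly_ring H M"
  using module_M by (auto simp: submodule_def hsub_def)

lemma (in graded_forms) submodule_sum:
  assumes "submodule mpoly_ring H M" and "\<And>a. a \<in> A \<Longrightarrow> f a \<in> H"
  shows "(\<Sum>a\<in>A. f a) \<in> H"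
  using assms(2) submodule.zero_closed[OF assms(1)] submodule.m_closed[OF assms(1)]
  by (induction A rule: infinite_finite_induct) auto

text \<open>A form with coefficients in I is the sum of its coefficients times basis vectors, and
  each summand is one of the generating products. Membership can then be checked
  coefficientwise.\<close>

lemma ideal_times_forms:
  fixes I :: "('v::finite, 'k::field) mpoly set" and A :: "'p::finite set"
  assumes I: "homog_ideal I"
  shows "ideal_times mpoly_ring (forms A) I = pointwise A I"
proof -
  interpret F: graded_forms "forms A :: (('v, 'k) mpoly, 'p \<Rightarrow> _) module" "forms_part A 0" "form_comp 0"
    by (rule graded_forms_forms)
  interpret Module.module "mpoly_ring :: ('v, 'k) mpoly ring" "forms A :: (('v, 'k) mpoly, 'p \<Rightarrow> _) module"
    by (rule F.module_M)
  define E where "E = {a \<odot>\<^bsub>forms A\<^esub> x | a x. a \<in> I \<and> x \<in> carrier (forms A)}"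
  have E: "E \<subseteq> carrier (forms A)"
    by (auto simp: E_def F.carrier_smult)
  have "span E \<subseteq> pointwise A I"
    by (rule span_is_subset[OF _ F.submodule_hsub[OF hsub_pointwise[OF I]]])
      (use I in \<open>auto simp: E_def carrier_forms smult_forms pointwise_def homog_ideal_def ideal_mult_right\<close>)
  moreover have "\<omega> \<in> span E" if \<omega>: "\<omega> \<in> pointwise A I" for \<omega>
  proof -
    define g where "g = (\<lambda>p q. (if q = p then \<omega> p else 0))"
    have "g p \<in> E" if "p \<in> A" for p
      unfolding E_def using \<omega> that
      by (intro CollectI exI[of _ "\<omega> p"] exI[of _ "\<lambda>q. if q = p then 1 else 0"])
        (auto simp: g_def carrier_forms smult_forms pointwise_def)
    then have "(\<Sum>p\<in>A. g p) \<in> span E"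
      using in_own_span[OF E] by (intro F.submodule_sum[OF span_is_submodule[OF E]]) auto
    moreover have "(\<Sum>p\<in>A. g p) q = (\<Sum>p\<in>A. g p q)" for q
      by (induction A rule: infinite_finite_induct) auto
    then have "(\<Sum>p\<in>A. g p) = \<omega>"
      using \<omega> by (auto simp: g_def pointwise_def fun_eq_iff)
    ultimately show ?thesis by simp
  qed
  ultimately show ?thesis
    by (auto simp: ideal_times_def E_def)
qed

section \<open>The exterior derivative in coordinates\<close>

lemma d1_eq: "d1 \<omega> = (\<lambda>(i, j). if i < j then partial_deriv i (\<omega> j) - partial_deriv j (\<omega> i) else 0)"
  by (auto simp: d1_def wedge_def d0_def dX_def fun_eq_iff sum_subtractf if_distrib[of "(*) _"]
      cong: if_cong)

lemma d1_add: "d1 (\<omega> + \<eta>) = d1 \<omega> + d1 \<eta>"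
  by (auto simp: d1_eq fun_eq_iff partial_deriv_add)

lemma d1_zero: "d1 0 = 0"
  by (auto simp: d1_eq fun_eq_iff)

lemma d1_smult: "d1 (\<lambda>i. F * \<omega> i) = wedge (d0 F) \<omega> + (\<lambda>p. F * d1 \<omega> p)"
  by (auto simp: d1_eq wedge_def d0_def fun_eq_iff partial_deriv_mult algebra_simps)

lemma d1_d0: "d1 (d0 F) = 0"
  by (auto simp: d1_eq d0_def fun_eq_iff partial_deriv_commute)

lemma form_comp_d1: "form_comp (Suc k) d (d1 \<omega>) = d1 (form_comp k d \<omega>)"
  by (auto simp: d1_eq form_comp_def fun_eq_iff hcomp_diff hcomp_partial_deriv)

lemma d1_in_pointwise:
  assumes "\<And>i. \<omega> i \<in> J" and "\<And>F i. F \<in> J \<Longrightarrow> partial_deriv i F \<in> I" and "ideal I mpoly_ring"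
  shows "d1 \<omega> \<in> pointwise upper I"
  using assms by (auto simp: d1_eq pointwise_def intro: ideal_diff)

lemma d1_in_forms_part: "\<omega> \<in> forms_part UNIV (Suc 0) d \<Longrightarrow> d1 \<omega> \<in> forms_part upper 2 d"
  by (auto simp: d1_eq forms_part_def homog_shift_iff hcomp_diff numeral_2_eq_2 hcomp_partial_deriv)

lemma wedge_in_pointwise:
  assumes "\<And>i. \<omega> i \<in> I" and "ideal I mpoly_ring"
  shows "wedge \<eta> \<omega> \<in> pointwise upper I"
  using assms by (auto simp: wedge_def pointwise_def intro!: ideal_diff ideal_mult_left)

text \<open>Modulo \<open>I \<Omega>\<^sup>2\<close>, a generator \<open>dF \<and> \<omega>\<close> is the exact form \<open>d(F \<omega>)\<close>, and exact forms
  \<open>d \<omega>\<close> with \<open>\<omega> \<in> I \<Omega>\<^sup>1\<close> are stable under multiplication.\<close>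

lemma hsub_exact:
  fixes I :: "('v::{finite,linorder}, 'k::field) mpoly set"
  assumes hI: "homog_ideal I"
  shows "graded_forms.hsub (forms upper) (form_comp 2)
    {h + d1 \<omega> | h \<omega>. h \<in> pointwise upper I \<and> \<omega> \<in> pointwise UNIV I}" (is "graded_forms.hsub _ _ ?H")
proof -
  interpret F1: graded_forms "forms UNIV :: (('v, 'k) mpoly, 'v \<Rightarrow> _) module" "forms_part UNIV 1" "form_comp 1"
    by (rule graded_forms_forms)
  interpret F2: graded_forms "forms upper :: (('v, 'k) mpoly, 'v \<times> 'v \<Rightarrow> _) module"
    "forms_part upper 2" "form_comp 2"
    by (rule graded_forms_forms)
  have I: "ideal I mpoly_ring"
    using hI by (simp add: homog_ideal_def)
  note h1 = hsub_pointwise[OF hI, where A = "UNIV :: 'v set" and k = 1]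
  note h2 = hsub_pointwise[OF hI, where A = "upper :: ('v \<times> 'v) set" and k = 2]
  show ?thesis
    unfolding F2.hsub_def
  proof (intro conjI ballI allI)
    show "?H \<subseteq> carrier (forms upper)"
      by (auto simp: carrier_forms pointwise_def d1_eq)
    show "0 \<in> ?H"
      using F1.hsub_zero[OF h1] F2.hsub_zero[OF h2] by (force simp: d1_zero)
    show "x + y \<in> ?H" if xy: "x \<in> ?H" "y \<in> ?H" for x y
    proof -
      obtain h \<omega> h' \<omega>' where "x = h + d1 \<omega>" "y = h' + d1 \<omega>'" "h \<in> pointwise upper I" "h' \<in> pointwise upper I"
        "\<omega> \<in> pointwise UNIV I" "\<omega>' \<in> pointwise UNIV I"
        using xy by blast
      then show ?thesis
        by (intro CollectI exI[of _ "h + h'"] exI[of _ "\<omega> + \<omega>'"])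
          (auto simp: d1_add F1.hsub_add[OF h1] F2.hsub_add[OF h2])
    qed
    show "F \<odot>\<^bsub>forms upper\<^esub> x \<in> ?H" if x: "x \<in> ?H" for F x
    proof -
      obtain h \<omega> where h: "x = h + d1 \<omega>" "h \<in> pointwise upper I" "\<omega> \<in> pointwise UNIV I"
        using x by blast
      have "wedge (d0 F) \<omega> \<in> pointwise upper I"
        using h(3) by (intro wedge_in_pointwise I) (auto simp: pointwise_def)
      with h have "F \<odot>\<^bsub>forms upper\<^esub> h - wedge (d0 F) \<omega> \<in> pointwise upper I"
        by (intro F2.hsub_diff[OF h2] F2.hsub_smult[OF h2])
      \<comment> \<open>F (h + d\<omega>) = (F h - dF \<and> \<omega>) + d(F \<omega>): the Leibniz
        defect has coefficients in I and is absorbed by the first summand.\<close>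
      moreover have "F \<odot>\<^bsub>forms upper\<^esub> x = F \<odot>\<^bsub>forms upper\<^esub> h - wedge (d0 F) \<omega> + d1 (F \<odot>\<^bsub>forms UNIV\<^esub> \<omega>)"
        by (simp add: h(1) smult_forms d1_smult fun_eq_iff algebra_simps)
      ultimately show ?thesis
        using F1.hsub_smult[OF h1 h(3)] by blast
    qed
    show "form_comp 2 d x \<in> ?H" if x: "x \<in> ?H" for d x
    proof -
      obtain h \<omega> where h: "x = h + d1 \<omega>" "h \<in> pointwise upper I" "\<omega> \<in> pointwise UNIV I"
        using x by blast
      have "form_comp 2 d x = form_comp 2 d h + d1 (form_comp 1 d \<omega>)"
        by (simp only: h(1) F2.pr_add form_comp_d1[of 1, unfolded Suc_1])
      then show ?thesis
        using F1.hsub_pr[OF h1 h(3)] F2.hsub_pr[OF h2 h(2)] by blast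
    qed
  qed
qed

text \<open>One inclusion is dF \<and> \<omega> = - F d\<omega> + d(F \<omega>) together with
  closure of the right-hand side under S. The other holds because d\<omega> is the sum of the
  generators d(\<omega>_i) \<and> dX_i. In this form a relation shows directly its preimage under
  \<beta>.\<close>

lemma kaehler2_relations_eq:
  fixes I :: "('v::{finite,linorder}, 'k::field) mpoly set"
  assumes hI: "homog_ideal I"
  shows "kaehler2_relations I = {h + d1 \<omega> | h \<omega>. h \<in> pointwise upper I \<and> \<omega> \<in> pointwise UNIV I}"
    (is "_ = ?H")
proof -
  interpret F: graded_forms "forms upper :: (('v, 'k) mpoly, 'v \<times> 'v \<Rightarrow> _) module"
    "forms_part upper 2" "form_comp 2"
    by (rule graded_forms_forms)
  interpret Module.module "mpoly_ring :: ('v, 'k) mpoly ring" "forms upper :: (('v, 'k) mpoly, 'v \<times> 'v \<Rightarrow> _) module"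
    by (rule F.module_M)
  have I: "ideal I mpoly_ring"
    using hI by (simp add: homog_ideal_def)
  note hI2 = hsub_pointwise[OF hI, where A = "upper :: ('v \<times> 'v) set" and k = 2]
  define E where "E = {wedge (d0 F) \<omega> | F \<omega>. F \<in> I \<and> \<omega> \<in> carrier (Omega1 :: (('v, 'k) mpoly, _) module)}"
  have E: "E \<subseteq> carrier (forms upper)"
    by (auto simp: E_def carrier_forms pointwise_def wedge_def)
  have EH: "E \<subseteq> ?H"
  proof
    fix w assume "w \<in> E"
    then obtain F \<omega> where F: "w = wedge (d0 F) \<omega>" "F \<in> I"
      by (auto simp: E_def)
    then have "w = (\<lambda>p. - F * d1 \<omega> p) + d1 (\<lambda>i. F * \<omega> i)"
      by (simp add: d1_smult fun_eq_iff)
    moreover have "(\<lambda>p. - F * d1 \<omega> p) \<in> pointwise upper I"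
      using F(2) by (auto simp: pointwise_def d1_eq intro!: ideal_mult_right[OF I] ideal_uminus[OF I])
    moreover have "(\<lambda>i. F * \<omega> i) \<in> pointwise UNIV I"
      using F(2) by (auto simp: pointwise_def intro!: ideal_mult_right[OF I])
    ultimately show "w \<in> ?H" by blast
  qed
  have "span E \<subseteq> ?H"
    by (rule span_is_subset[OF EH F.submodule_hsub[OF hsub_exact[OF hI]]])
  moreover have "d1 \<omega> \<in> span E" if "\<omega> \<in> pointwise UNIV I" for \<omega>
  proof -
    have "wedge (d0 (\<omega> i)) (dX i) \<in> span E" for i
      using in_own_span[OF E] that by (auto simp: E_def Omega1_def pointwise_def)
    then have "(\<Sum>i\<in>UNIV. wedge (d0 (\<omega> i)) (dX i)) \<in> span E"
      by (intro F.submodule_sum[OF span_is_submodule[OF E]])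
    moreover have "(\<Sum>i\<in>UNIV. wedge (d0 (\<omega> i)) (dX i)) = d1 \<omega>"
    proof
      fix p
      have "(\<Sum>i\<in>J. wedge (d0 (\<omega> i)) (dX i)) p = (\<Sum>i\<in>J. wedge (d0 (\<omega> i)) (dX i) p)" for J
        by (induction J rule: infinite_finite_induct) auto
      then show "(\<Sum>i\<in>UNIV. wedge (d0 (\<omega> i)) (dX i)) p = d1 \<omega> p"
        by (simp add: d1_def)
    qed
    ultimately show ?thesis by simp
  qed
  moreover have "h + x \<in> ?H" if h: "h \<in> pointwise upper I" and x: "x \<in> ?H" for h x
  proof -
    obtain h' \<omega> where "x = h' + d1 \<omega>" "h' \<in> pointwise upper I" "\<omega> \<in> pointwise UNIV I"
      using x by blast
    then show ?thesis
      using F.hsub_add[OF hI2 h] by (auto simp flip: add.assoc)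
  qed
  ultimately show ?thesis
    unfolding kaehler2_relations_def Omega2_eq ideal_times_forms[OF hI] E_def[symmetric] set_add_def'
    by auto blast+
qed

text \<open>The square of the index set splits into the pairs with i < j, their mirror images and
  the diagonal, so (n+1)^2 is twice the number sought plus n + 1.\<close>

lemma card_upper:
  assumes "card (UNIV :: 'v::{finite,linorder} set) = n + 1"
  shows "2 * card (upper :: ('v \<times> 'v) set) = n * (n + 1)"
proof -
  let ?U = "upper :: ('v \<times> 'v) set"
  have "card (prod.swap ` ?U) = card ?U"
    by (rule card_image) (auto simp: inj_on_def)
  moreover have "UNIV = (?U \<union> prod.swap ` ?U) \<union> (\<lambda>i. (i, i)) ` UNIV"
    by (auto simp: image_iff)
  then have "card (UNIV :: ('v \<times> 'v) set) = card ((?U \<union> prod.swap ` ?U) \<union> (\<lambda>i. (i, i)) ` UNIV)"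
    by simp
  moreover have "\<dots> = card (?U \<union> prod.swap ` ?U) + card ((\<lambda>i :: 'v. (i, i)) ` UNIV)"
    by (rule card_Un_disjoint) auto
  moreover have "card (?U \<union> prod.swap ` ?U) = card ?U + card (prod.swap ` ?U)"
    by (rule card_Un_disjoint) auto
  moreover have "card ((\<lambda>i :: 'v. (i, i)) ` UNIV) = n + 1"
    by (subst card_image) (auto simp: inj_on_def assms)
  moreover have "card (UNIV :: ('v \<times> 'v) set) = (n + 1) * (n + 1)"
    by (simp add: assms flip: UNIV_Times_UNIV add: card_cartesian_product)
  ultimately show ?thesis
    by (simp add: algebra_simps)
qed


section \<open>The complex\<close>

text \<open>All that the complex requires of the fat points: \<open>I00\<close> and
  \<open>I01\<close> make the two left terms modules over S/\<open>I0\<close>, \<open>deriv1\<close>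
  and \<open>deriv2\<close> make \<alpha> and \<beta> well defined, and \<open>crit\<close> makes
  \<alpha> injective.\<close>

locale fattening_chain =
  fixes I0 I1 I2 :: "('v::{finite,linorder}, 'k::field) mpoly set"
  assumes h0: "homog_ideal I0" and h1: "homog_ideal I1" and h2: "homog_ideal I2"
    and I10: "I1 \<subseteq> I0" and I21: "I2 \<subseteq> I1"
    and I00: "F \<in> I0 \<Longrightarrow> H \<in> I0 \<Longrightarrow> F * H \<in> I1"
    and I01: "F \<in> I0 \<Longrightarrow> H \<in> I1 \<Longrightarrow> F * H \<in> I2"
    and deriv1: "F \<in> I1 \<Longrightarrow> partial_deriv i F \<in> I0"
    and deriv2: "F \<in> I2 \<Longrightarrow> partial_deriv i F \<in> I1"
    and crit: "F \<in> I1 \<Longrightarrow> (\<And>i. partial_deriv i F \<in> I1) \<Longrightarrow> F \<in> I2"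
begin

lemma ideals: "ideal I0 mpoly_ring" "ideal I1 mpoly_ring" "ideal I2 mpoly_ring"
  using h0 h1 h2 by (simp_all add: homog_ideal_def)

definition "N2 = (pointwise UNIV I1 :: ('v, 'k) form1 set)"
definition "N3 = (pointwise upper I0 :: ('v, 'k) form2 set)"
abbreviation "rel \<equiv> kaehler2_relations I0"

lemma rel: "rel = {h + d1 \<omega> | h \<omega>. h \<in> N3 \<and> \<omega> \<in> pointwise UNIV I0}"
  by (simp add: kaehler2_relations_eq[OF h0] N3_def)

sublocale S1: graded_subquotient "regular_module mpoly_ring" poly_part "hcomp 0" I0 I1 I2
  by (rule graded_subquotient_polys[OF h0 h1 h2 I21 I01])

sublocale F1: graded_forms "forms UNIV :: (('v, 'k) mpoly, ('v, 'k) form1) module" "forms_part UNIV 1" "form_comp 1"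
  by (rule graded_forms_forms)

sublocale F2: graded_forms "forms upper :: (('v, 'k) mpoly, ('v, 'k) form2) module" "forms_part upper 2" "form_comp 2"
  by (rule graded_forms_forms)

sublocale S2: graded_subquotient "forms UNIV :: (('v, 'k) mpoly, ('v, 'k) form1) module"
  "forms_part UNIV 1" "form_comp 1" I0 "pointwise UNIV I0" N2
proof unfold_locales
  show "F1.hsub (pointwise UNIV I0)" "F1.hsub N2"
    using hsub_pointwise h0 h1 by (auto simp: N2_def)
qed (use I10 I00 in \<open>auto simp: h0 N2_def pointwise_def smult_forms\<close>)

sublocale S3: graded_subquotient "forms upper :: (('v, 'k) mpoly, ('v, 'k) form2) module"
  "forms_part upper 2" "form_comp 2" I0 "carrier (forms upper)" N3
proof unfold_locales
  show hN3: "F2.hsub N3"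
    using hsub_pointwise[OF h0] by (auto simp: N3_def)
  show "N3 \<subseteq> carrier (forms upper)"
    by (rule F2.hsub_carrier[OF hN3])
  show "F2.hsub (carrier (forms upper))"
    by (rule F2.hsub_carrier_M)
qed (auto simp: h0 N3_def pointwise_def smult_forms carrier_forms ideal_mult_right[OF ideals(1)])

lemma N3_rel: "N3 \<subseteq> rel"
  using F1.hsub_zero[OF S2.hU] by (force simp: rel d1_zero)

sublocale S4: graded_subquotient "forms upper :: (('v, 'k) mpoly, ('v, 'k) form2) module"
  "forms_part upper 2" "form_comp 2" I0 "carrier (forms upper)" rel
proof unfold_locales
  show hrel: "F2.hsub rel"
    using hsub_exact[OF h0] by (simp add: kaehler2_relations_eq[OF h0])
  show "rel \<subseteq> carrier (forms upper)"
    by (rule F2.hsub_carrier[OF hrel])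
qed (use N3_rel S3.ann in \<open>auto simp: h0 F2.hsub_carrier_M\<close>)

text \<open>The defect d(rF) - r dF = F dr has coefficients in \<open>I1\<close> because F
  does.\<close>

sublocale \<alpha>: graded_subquotient_hom "regular_module mpoly_ring" poly_part "hcomp 0"
  "forms UNIV :: (('v, 'k) mpoly, ('v, 'k) form1) module" "forms_part UNIV 1" "form_comp 1"
  I0 I1 I2 "pointwise UNIV I0" N2 d0
proof unfold_locales
  show "d0 F \<in> forms_part UNIV 1 d" if "F \<in> poly_part d" for F :: "('v, 'k) mpoly" and d
    using that by (auto simp: forms_part_def d0_def homog_shift_iff hcomp_partial_deriv)
  show "d0 (r \<odot>\<^bsub>regular_module mpoly_ring\<^esub> F) - r \<odot>\<^bsub>forms UNIV\<^esub> d0 F \<in> N2"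
    if "F \<in> I1" for F r :: "('v, 'k) mpoly"
    using that by (auto simp: N2_def pointwise_def d0_def smult_forms partial_deriv_mult
        intro: ideal_mult_left[OF ideals(2)])
qed (auto simp: N2_def pointwise_def d0_def deriv1 deriv2 partial_deriv_add fun_eq_iff)

text \<open>The defect d(r \<omega>) - r d\<omega> = dr \<and> \<omega> has coefficients in
  \<open>I0\<close> because \<omega> does.\<close>

sublocale \<beta>: graded_subquotient_hom "forms UNIV :: (('v, 'k) mpoly, ('v, 'k) form1) module"
  "forms_part UNIV 1" "form_comp 1"
  "forms upper :: (('v, 'k) mpoly, ('v, 'k) form2) module" "forms_part upper 2" "form_comp 2"
  I0 "pointwise UNIV I0" N2 "carrier (forms upper)" N3 d1
proof unfold_locales
  show "d1 \<omega> \<in> carrier (forms upper)" for \<omega> :: "('v, 'k) form1"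
    by (auto simp: carrier_forms pointwise_def d1_eq)
  show "d1 \<omega> \<in> N3" if "\<omega> \<in> N2" for \<omega>
    unfolding N3_def using that deriv1 ideals(1)
    by (intro d1_in_pointwise[where J = I1]) (auto simp: N2_def pointwise_def)
  show "d1 (r \<odot>\<^bsub>forms UNIV\<^esub> \<omega>) - r \<odot>\<^bsub>forms upper\<^esub> d1 \<omega> \<in> N3" if "\<omega> \<in> pointwise UNIV I0" for r \<omega>
  proof -
    have "wedge (d0 r) \<omega> \<in> N3"
      unfolding N3_def using that by (intro wedge_in_pointwise ideals) (auto simp: pointwise_def)
    then show ?thesis
      by (simp add: smult_forms d1_smult)
  qed
  show "d1 \<omega> \<in> forms_part upper 2 d" if "\<omega> \<in> forms_part UNIV 1 d" for \<omega> :: "('v, 'k) form1" and d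
    using that by (simp add: d1_in_forms_part)
qed (simp add: d1_add)

sublocale \<gamma>: graded_subquotient_hom "forms upper :: (('v, 'k) mpoly, ('v, 'k) form2) module"
  "forms_part upper 2" "form_comp 2"
  "forms upper :: (('v, 'k) mpoly, ('v, 'k) form2) module" "forms_part upper 2" "form_comp 2"
  I0 "carrier (forms upper)" N3 "carrier (forms upper)" rel "\<lambda>H. H"
  by unfold_locales (use N3_rel F2.hsub_zero[OF S4.hN] in auto)

lemma beta_alpha: "x \<in> carrier S1.Q \<Longrightarrow> \<beta>.fbar (\<alpha>.fbar x) = \<zero>\<^bsub>S3.Q\<^esub>"
  by (auto simp: S1.carrier_Q \<alpha>.fbar_coset \<beta>.fbar_coset \<alpha>.f_U d1_d0 S3.zero_Q)

lemma gamma_beta: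
  assumes "x \<in> carrier S2.Q"
  shows "\<gamma>.fbar (\<beta>.fbar x) = \<zero>\<^bsub>S4.Q\<^esub>"
proof -
  obtain \<omega> where \<omega>: "x = N2 +>\<^bsub>forms UNIV\<^esub> \<omega>" "\<omega> \<in> pointwise UNIV I0"
    using assms by (auto simp: S2.carrier_Q)
  then have "0 + d1 \<omega> \<in> rel"
    unfolding rel using F2.hsub_zero[OF S3.hN] by blast
  with \<omega> show ?thesis
    by (simp add: \<beta>.fbar_coset \<gamma>.fbar_coset \<beta>.f_U S4.zero_Q F2.coset_eq_zero_iff[OF S4.hN])
qed

lemma inj_alpha: "inj_on \<alpha>.fbar (carrier S1.Q)"
proof (rule inj_onI)
  fix x y assume "x \<in> carrier S1.Q" "y \<in> carrier S1.Q" "\<alpha>.fbar x = \<alpha>.fbar y"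
  then obtain F H where F: "x = I2 +>\<^bsub>regular_module mpoly_ring\<^esub> F" "F \<in> I1"
    and H: "y = I2 +>\<^bsub>regular_module mpoly_ring\<^esub> H" "H \<in> I1"
    and eq: "N2 +>\<^bsub>forms UNIV\<^esub> d0 F = N2 +>\<^bsub>forms UNIV\<^esub> d0 H"
    by (auto simp: S1.carrier_Q \<alpha>.fbar_coset)
  from eq have "d0 F - d0 H \<in> N2"
    by (simp add: F1.coset_eq_iff[OF S2.hN])
  then have "partial_deriv i (F - H) \<in> I1" for i
    by (simp add: N2_def pointwise_def d0_def partial_deriv_diff)
  moreover have "F - H \<in> I1"
    using F(2) H(2) by (rule ideal_diff[OF ideals(2)])
  ultimately have "F - H \<in> I2"
    by (intro crit)
  then show "x = y"
    by (simp add: F H polys.coset_eq_iff[OF S1.hN])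
qed

lemma surj_gamma: "\<gamma>.fbar ` carrier S3.Q = carrier S4.Q"
proof -
  have "rel +>\<^bsub>forms upper\<^esub> H \<in> \<gamma>.fbar ` carrier S3.Q" if "H \<in> carrier (forms upper)" for H
    using that by (intro image_eqI[of _ _ "N3 +>\<^bsub>forms upper\<^esub> H"]) (auto simp: S3.carrier_Q \<gamma>.fbar_coset)
  then show ?thesis
    by (auto simp: S3.carrier_Q S4.carrier_Q \<gamma>.fbar_coset)
qed

lemma surj_gamma_part: "\<gamma>.fbar ` S3.QG d = S4.QG d"
proof -
  have "rel +>\<^bsub>forms upper\<^esub> H \<in> \<gamma>.fbar ` S3.QG d"
    if "H \<in> carrier (forms upper)" "H \<in> forms_part upper 2 d" for H
    using that by (intro image_eqI[of _ _ "N3 +>\<^bsub>forms upper\<^esub> H"])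
      (auto simp: subquotient_part_def \<gamma>.fbar_coset)
  then show ?thesis
    by (auto simp: subquotient_part_def \<gamma>.fbar_coset)
qed

lemma ker_gamma: "\<beta>.fbar ` carrier S2.Q = a_kernel S3.Q S4.Q \<gamma>.fbar"
proof
  show "\<beta>.fbar ` carrier S2.Q \<subseteq> a_kernel S3.Q S4.Q \<gamma>.fbar"
    using gamma_beta \<beta>.f_U by (auto simp: a_kernel_def' S2.carrier_Q S3.carrier_Q \<beta>.fbar_coset)
  show "a_kernel S3.Q S4.Q \<gamma>.fbar \<subseteq> \<beta>.fbar ` carrier S2.Q"
  proof
    fix x assume "x \<in> a_kernel S3.Q S4.Q \<gamma>.fbar"
    then obtain H where "x = N3 +>\<^bsub>forms upper\<^esub> H" "H \<in> rel"
      by (auto simp: a_kernel_def' S3.carrier_Q \<gamma>.fbar_coset S4.zero_Q F2.coset_eq_zero_iff[OF S4.hN])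
    moreover from this obtain h \<omega> where "H = h + d1 \<omega>" "h \<in> N3" "\<omega> \<in> pointwise UNIV I0"
      by (auto simp: rel)
    ultimately have "x = \<beta>.fbar (N2 +>\<^bsub>forms UNIV\<^esub> \<omega>)" "\<omega> \<in> pointwise UNIV I0"
      by (simp_all add: \<beta>.fbar_coset F2.coset_eq_iff[OF S3.hN])
    then show "x \<in> \<beta>.fbar ` carrier S2.Q"
      by (auto simp: S2.carrier_Q)
  qed
qed

text \<open>A dimension count in a fixed degree needs a homogeneous preimage. Projecting H = h +
  d\<omega> to degree d provides one, since d commutes with projections and \<open>I0\<close> is
  homogeneous.\<close>

lemma ker_gamma_part:
  assumes y: "y \<in> S3.QG d" and ker: "\<gamma>.fbar y = \<zero>\<^bsub>S4.Q\<^esub>"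
  shows "y \<in> \<beta>.fbar ` S2.QG d"
proof -
  obtain H where H: "y = N3 +>\<^bsub>forms upper\<^esub> H" "H \<in> carrier (forms upper)" "H \<in> forms_part upper 2 d"
    using y by (auto simp: subquotient_part_def)
  with ker have "H \<in> rel"
    by (simp add: \<gamma>.fbar_coset S4.zero_Q F2.coset_eq_zero_iff[OF S4.hN])
  then obtain h \<omega> where h: "H = h + d1 \<omega>" "h \<in> N3" "\<omega> \<in> pointwise UNIV I0"
    by (auto simp: rel)
  have "H = form_comp 2 d H"
    using H(3) by (simp add: F2.G_iff)
  also have "\<dots> = form_comp 2 d h + d1 (form_comp 1 d \<omega>)"
    by (simp only: h(1) F2.pr_add form_comp_d1[of 1, unfolded Suc_1])
  finally have "y = N3 +>\<^bsub>forms upper\<^esub> d1 (form_comp 1 d \<omega>)"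
    using F2.hsub_pr[OF S3.hN h(2)] by (simp add: H(1) F2.coset_eq_iff[OF S3.hN])
  moreover have "form_comp 1 d \<omega> \<in> pointwise UNIV I0"
    by (rule F1.hsub_pr[OF S2.hU h(3)])
  moreover from this have "form_comp 1 d \<omega> \<in> forms_part UNIV 1 d"
    using F1.hsub_carrier[OF S2.hU] by (auto simp: F1.G_iff F1.pr_pr simp del: One_nat_def)
  ultimately show ?thesis
    by (auto simp: subquotient_part_def \<beta>.fbar_coset intro!: image_eqI[of _ _ "N2 +>\<^bsub>forms UNIV\<^esub> form_comp 1 d \<omega>"])
qed

section \<open>The dimension count\<close>

abbreviation "sdim \<equiv> kdim (regular_module (mpoly_ring :: ('v, 'k) mpoly ring))"

lemma ksub_ideal: "homog_ideal I \<Longrightarrow> polys.ksub (I \<inter> poly_part d)"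
  by (rule polys.ksub_hsub) (simp add: hsub_polys_iff)

lemma sdim_fin: "homog_ideal I \<Longrightarrow> kfin_dim (regular_module mpoly_ring) (I \<inter> poly_part d)"
  using ksub_ideal[of UNIV d] ksub_ideal[of I d]
  by (intro polys.kfin_dim_mono[OF _ _ _ kfin_dim_poly_part[of d]])
    (auto simp: homog_ideal_def ideal_iff)

lemma pointwise_part:
  fixes A B :: "'p::finite set"
  assumes V: "homog_ideal V"
  shows "kfin_dim (forms B) (pointwise A V \<inter> forms_part A k (e + k))"
    and "kdim (forms B) (pointwise A V \<inter> forms_part A k (e + k)) = card A * sdim (V \<inter> poly_part e)"
proof -
  have "0 \<in> V"
    using V by (simp add: homog_ideal_def ideal_iff)
  then show "kfin_dim (forms B) (pointwise A V \<inter> forms_part A k (e + k))"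
    and "kdim (forms B) (pointwise A V \<inter> forms_part A k (e + k)) = card A * sdim (V \<inter> poly_part e)"
    using kdim_pointwise[OF ksub_ideal[OF V, of e], of e] by (simp_all add: pointwise_inter_part)
qed

lemma homog_ideal_UNIV: "homog_ideal (UNIV :: ('v, 'k) mpoly set)"
  by (simp add: homog_ideal_def ideal_iff)

text \<open>A 1-form of degree e + 1 and a 2-form of degree e + 2 both have coefficients of degree
  e, whence the shifts. The cardinalities are the ranks of the free modules.\<close>

lemma hilbert_quotients:
  shows hilbert_Q1: "hilbert_function I0 S1.Q S1.QG d + sdim (I2 \<inter> poly_part d) = sdim (I1 \<inter> poly_part d)"
    and hilbert_Q2: "hilbert_function I0 S2.Q S2.QG (e + 1) + card (UNIV :: 'v set) * sdim (I1 \<inter> poly_part e) =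
      card (UNIV :: 'v set) * sdim (I0 \<inter> poly_part e)"
    and hilbert_Q3: "hilbert_function I0 S3.Q S3.QG (e + 2) + card (upper :: ('v \<times> 'v) set) * sdim (I0 \<inter> poly_part e) =
      card (upper :: ('v \<times> 'v) set) * sdim (poly_part e)"
    and fin_dim_Q1: "vectorspace.fin_dim (ring_of_type_algebra :: 'k ring) (hvec I0 S1.Q (S1.QG d))"
    and fin_dim_Q2: "vectorspace.fin_dim (ring_of_type_algebra :: 'k ring) (hvec I0 S2.Q (S2.QG (e + 1)))"
    and fin_dim_Q3: "vectorspace.fin_dim (ring_of_type_algebra :: 'k ring) (hvec I0 S3.Q (S3.QG (e + 2)))"
proof -
  note fin2 = pointwise_part(1)[OF h0, of "UNIV :: 'v set" "UNIV :: 'v set" 1 e]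
  have fin3: "kfin_dim (forms upper :: (('v, 'k) mpoly, ('v, 'k) form2) module) (carrier (forms upper) \<inter> forms_part (upper :: ('v \<times> 'v) set) 2 (e + 2))"
    unfolding carrier_forms by (rule pointwise_part(1)[OF homog_ideal_UNIV])
  show "hilbert_function I0 S1.Q S1.QG d + sdim (I2 \<inter> poly_part d) = sdim (I1 \<inter> poly_part d)"
    and "vectorspace.fin_dim (ring_of_type_algebra :: 'k ring) (hvec I0 S1.Q (S1.QG d))"
    by (rule S1.hilbert_function_Q[OF sdim_fin[OF h1]])+
  show "vectorspace.fin_dim (ring_of_type_algebra :: 'k ring) (hvec I0 S2.Q (S2.QG (e + 1)))"
    by (rule S2.hilbert_function_Q(1)[OF fin2])
  show "vectorspace.fin_dim (ring_of_type_algebra :: 'k ring) (hvec I0 S3.Q (S3.QG (e + 2)))"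
    by (rule S3.hilbert_function_Q(1)[OF fin3])
  show "hilbert_function I0 S2.Q S2.QG (e + 1) + card (UNIV :: 'v set) * sdim (I1 \<inter> poly_part e) =
      card (UNIV :: 'v set) * sdim (I0 \<inter> poly_part e)"
    using S2.hilbert_function_Q(2)[OF fin2] unfolding N2_def pointwise_part(2)[OF h0] pointwise_part(2)[OF h1] .
  show "hilbert_function I0 S3.Q S3.QG (e + 2) + card (upper :: ('v \<times> 'v) set) * sdim (I0 \<inter> poly_part e) =
      card (upper :: ('v \<times> 'v) set) * sdim (poly_part e)"
    using S3.hilbert_function_Q(2)[OF fin3]
    unfolding N3_def pointwise_part(2)[OF h0] unfolding carrier_forms pointwise_part(2)[OF homog_ideal_UNIV]
    by simp
qed

lemma hilbert_inequality:
  "hilbert_function I0 S3.Q S3.QG (i + 2) + hilbert_function I0 S1.Q S1.QG (i + 2)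
    \<le> hilbert_function I0 S4.Q S4.QG (i + 2) + hilbert_function I0 S2.Q S2.QG (i + 2)"
proof -
  define d where "d = i + 2"
  have QG: "S1.QG d \<subseteq> carrier S1.Q" "S2.QG d \<subseteq> carrier S2.Q" "S3.QG d \<subseteq> carrier S3.Q"
    by (auto simp: subquotient_part_def S1.carrier_Q S2.carrier_Q S3.carrier_Q)
  show ?thesis
    unfolding hilbert_function_hvec d_def[symmetric]
  proof (rule dim_complex)
    show "linear_map (ring_of_type_algebra :: 'k ring) (hvec I0 S1.Q (S1.QG d)) (hvec I0 S2.Q (S2.QG d)) \<alpha>.fbar"
      by (rule linear_map_hvec[OF \<alpha>.graded_hom_fbar ideals(1) QG(1) S1.vectorspace_hvec S2.vectorspace_hvec])
    show "linear_map (ring_of_type_algebra :: 'k ring) (hvec I0 S2.Q (S2.QG d)) (hvec I0 S3.Q (S3.QG d)) \<beta>.fbar"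
      by (rule linear_map_hvec[OF \<beta>.graded_hom_fbar ideals(1) QG(2) S2.vectorspace_hvec S3.vectorspace_hvec])
    show "linear_map (ring_of_type_algebra :: 'k ring) (hvec I0 S3.Q (S3.QG d)) (hvec I0 S4.Q (S4.QG d)) \<gamma>.fbar"
      by (rule linear_map_hvec[OF \<gamma>.graded_hom_fbar ideals(1) QG(3) S3.vectorspace_hvec S4.vectorspace_hvec])
    show "vectorspace.fin_dim (ring_of_type_algebra :: 'k ring) (hvec I0 S1.Q (S1.QG d))"
      by (rule fin_dim_Q1)
    show "vectorspace.fin_dim (ring_of_type_algebra :: 'k ring) (hvec I0 S2.Q (S2.QG d))"
      \<comment> \<open>Degree i + 2 of Omega^1 corresponds to coefficients of degree i + 1.\<close>
      using fin_dim_Q2[of "i + 1"] by (simp add: d_def)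
    show "vectorspace.fin_dim (ring_of_type_algebra :: 'k ring) (hvec I0 S3.Q (S3.QG d))"
      unfolding d_def by (rule fin_dim_Q3)
    show "inj_on \<alpha>.fbar (carrier (hvec I0 S1.Q (S1.QG d)))"
      using inj_on_subset[OF inj_alpha QG(1)] by (simp add: hvec_def)
    show "\<beta>.fbar (\<alpha>.fbar x) = \<zero>\<^bsub>hvec I0 S3.Q (S3.QG d)\<^esub>" if "x \<in> carrier (hvec I0 S1.Q (S1.QG d))" for x
      using that QG(1) beta_alpha by (auto simp: hvec_def)
    show "y \<in> \<beta>.fbar ` carrier (hvec I0 S2.Q (S2.QG d))"
      if "y \<in> carrier (hvec I0 S3.Q (S3.QG d))" "\<gamma>.fbar y = \<zero>\<^bsub>hvec I0 S4.Q (S4.QG d)\<^esub>" for y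
      using ker_gamma_part[of y d] that by (simp add: hvec_def)
    show "\<gamma>.fbar ` carrier (hvec I0 S3.Q (S3.QG d)) = carrier (hvec I0 S4.Q (S4.QG d))"
      using surj_gamma_part by (simp add: hvec_def)
  qed
qed

text \<open>Each Hilbert function of a scheme is dim S_d minus the dimension of the ideal in degree
  d. In the terms for \<open>I1\<close>/\<open>I2\<close> and for the 1-forms, dim S_d cancels and
  differences of Hilbert functions remain. The statement is over the reals because its right-hand
  side may be negative.\<close>

lemma hilbert_bound:
  assumes n: "card (UNIV :: 'v set) = n + 1"
  shows "real (hilbert_function I0 S4.Q S4.QG (i + 2)) \<ge>
    real n * (real n + 1) / 2 * real (HF_scheme I0 i)
    + real (HF_scheme I2 (i + 2)) - real (HF_scheme I1 (i + 2))
    - (real n + 1) * (real (HF_scheme I1 (i + 1)) - real (HF_scheme I0 (i + 1)))"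
proof -
  let ?c = "card (upper :: ('v \<times> 'v) set)"
  have c: "real ?c = real n * (real n + 1) / 2"
    using arg_cong[OF card_upper[OF n], of real] by (simp add: field_simps)
  have Q3: "real (hilbert_function I0 S3.Q S3.QG (i + 2)) = real ?c * real (HF_scheme I0 i)"
  proof -
    have "hilbert_function I0 S3.Q S3.QG (i + 2) + ?c * sdim (I0 \<inter> poly_part i) =
        ?c * (HF_scheme I0 i + sdim (I0 \<inter> poly_part i))"
      by (simp only: hilbert_Q3 HF_scheme_eq[OF h0])
    then have "hilbert_function I0 S3.Q S3.QG (i + 2) = ?c * HF_scheme I0 i"
      by (simp add: distrib_left)
    then show ?thesis by simp
  qed
  have Q1: "real (hilbert_function I0 S1.Q S1.QG (i + 2)) = real (HF_scheme I2 (i + 2)) - real (HF_scheme I1 (i + 2))"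
    using hilbert_Q1[of "i + 2"] HF_scheme_eq[OF h1, of "i + 2"] HF_scheme_eq[OF h2, of "i + 2"] by linarith
  have Q2: "real (hilbert_function I0 S2.Q S2.QG (i + 2)) =
      (real n + 1) * (real (HF_scheme I1 (i + 1)) - real (HF_scheme I0 (i + 1)))"
  proof -
    have "real (hilbert_function I0 S2.Q S2.QG (i + 2)) + (real n + 1) * real (sdim (I1 \<inter> poly_part (i + 1))) =
        (real n + 1) * real (sdim (I0 \<inter> poly_part (i + 1)))"
      using arg_cong[OF hilbert_Q2[of "i + 1"], of real] by (simp add: n algebra_simps)
    moreover have "real (HF_scheme I1 (i + 1)) - real (HF_scheme I0 (i + 1)) =
        real (sdim (I0 \<inter> poly_part (i + 1))) - real (sdim (I1 \<inter> poly_part (i + 1)))"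
      using HF_scheme_eq[OF h0, of "i + 1"] HF_scheme_eq[OF h1, of "i + 1"] by linarith
    ultimately show ?thesis
      by (simp only: right_diff_distrib)
  qed
  have "real (hilbert_function I0 S3.Q S3.QG (i + 2)) + real (hilbert_function I0 S1.Q S1.QG (i + 2))
      \<le> real (hilbert_function I0 S4.Q S4.QG (i + 2)) + real (hilbert_function I0 S2.Q S2.QG (i + 2))"
    using hilbert_inequality[of i] by linarith
  then show ?thesis
    unfolding Q1 Q2 Q3 c by linarith
qed

end

theorem proposition8p5:
  fixes P :: "nat \<Rightarrow> 'v::{finite,linorder} \<Rightarrow> 'k::field_char_0"
    and m :: "nat \<Rightarrow> nat" and n s :: nat
  assumes "card (UNIV :: 'v set) = n + 1" and "n \<ge> 1" and "s \<ge> 1"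
    and "\<forall>j\<in>{1..s}. P j (Min UNIV) \<noteq> 0"
    and "\<forall>j\<in>{1..s}. \<forall>l\<in>{1..s}. j \<noteq> l \<longrightarrow> \<not> same_point (P j) (P l)"
    and "\<forall>j\<in>{1..s}. m j \<ge> 1"
  defines "S \<equiv> (mpoly_ring :: ('v, 'k) mpoly ring)"
    and "I0 \<equiv> fat_ideal s P m"
    and "I1 \<equiv> fat_ideal s P (fattening m 1)"
    and "I2 \<equiv> fat_ideal s P (fattening m 2)"
  defines "N2 \<equiv> ideal_times S Omega1 I1"
    and "N3 \<equiv> ideal_times S Omega2 I0"
  defines "R \<equiv> coord_ring I0" and "RG \<equiv> coord_ring_part I0"
    and "M1 \<equiv> subquotient (regular_module S) I1 I2"
    and "G1 \<equiv> subquotient_part (regular_module S) poly_part I1 I2"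
    and "M2 \<equiv> subquotient Omega1 (ideal_times S Omega1 I0) N2"
    and "G2 \<equiv> subquotient_part Omega1 form1_part (ideal_times S Omega1 I0) N2"
    and "M3 \<equiv> subquotient Omega2 (carrier Omega2) N3"
    and "G3 \<equiv> subquotient_part Omega2 form2_part (carrier Omega2) N3"
    and "M4 \<equiv> Kaehler2 I0" and "G4 \<equiv> Kaehler2_part I0"
  shows
    "graded_module R RG M1 G1 \<and> graded_module R RG M2 G2 \<and>
     graded_module R RG M3 G3 \<and> graded_module R RG M4 G4 \<and>
     (\<exists>\<alpha> \<beta> \<gamma>.
        graded_hom R M1 G1 M2 G2 \<alpha> \<and> graded_hom R M2 G2 M3 G3 \<beta> \<and> graded_hom R M3 G3 M4 G4 \<gamma> \<and>
        (\<forall>F\<in>I1. \<alpha> (I2 +>\<^bsub>S\<^esub> F) = N2 +>\<^bsub>Omega1\<^esub> d0 F) \<and>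
        (\<forall>G\<in>I0. \<forall>i. \<beta> (N2 +>\<^bsub>Omega1\<^esub> (G \<odot>\<^bsub>Omega1\<^esub> dX i)) = N3 +>\<^bsub>Omega2\<^esub> d1 (G \<odot>\<^bsub>Omega1\<^esub> dX i)) \<and>
        (\<forall>H\<in>carrier Omega2. \<gamma> (N3 +>\<^bsub>Omega2\<^esub> H) = kaehler2_relations I0 +>\<^bsub>Omega2\<^esub> H) \<and>
        (\<forall>x\<in>carrier M1. \<beta> (\<alpha> x) = \<zero>\<^bsub>M3\<^esub>) \<and> (\<forall>x\<in>carrier M2. \<gamma> (\<beta> x) = \<zero>\<^bsub>M4\<^esub>) \<and>
        inj_on \<alpha> (carrier M1) \<and>
        \<gamma> ` carrier M3 = carrier M4 \<and>
        \<beta> ` carrier M2 = a_kernel M3 M4 \<gamma>) \<and>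
     (\<forall>i. real (hilbert_function I0 M4 G4 (i + 2)) \<ge>
        real n * (real n + 1) / 2 * real (HF_scheme I0 i)
        + real (HF_scheme I2 (i + 2)) - real (HF_scheme I1 (i + 2))
        - (real n + 1) * (real (HF_scheme I1 (i + 1)) - real (HF_scheme I0 (i + 1))))"
proof -
  let ?z = "Min (UNIV :: 'v set)"
  \<comment> \<open>The second fattening is read as the first fattening of the first one, so that
    the statements about a single step apply to both inclusions.\<close>
  have I1_eq: "I1 = fat_ideal s P (fattening m 1)" and I2_eq: "I2 = fat_ideal s P (fattening (fattening m 1) 1)"
    and I0_eq: "I0 = fat_ideal s P m"
    by (simp_all add: I0_def I1_def I2_def fattening_fattening numeral_2_eq_2)
  interpret C: fattening_chain I0 I1 I2
  proof
    show "homog_ideal I0" "homog_ideal I1" "homog_ideal I2"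
      by (simp_all add: I0_def I1_def I2_def homog_ideal_fat_ideal)
    show "I1 \<subseteq> I0" "I2 \<subseteq> I1"
      unfolding I0_def I1_def I2_def by (rule fat_ideal_antimono, simp add: fattening_def)+
    \<comment> \<open>Here m_j >= 1 enters, through m_j + m_j >= m_j + 1.\<close>
    show "F * H \<in> I1" if "F \<in> I0" "H \<in> I0" for F H
      using that unfolding I0_def I1_def
      by (rule fat_ideal_mult) (use assms(6) in \<open>auto simp: fattening_def\<close>)
    \<comment> \<open>Likewise m_j + (m_j + 1) >= m_j + 2.\<close>
    show "F * H \<in> I2" if "F \<in> I0" "H \<in> I1" for F H
      using that unfolding I0_def I1_def I2_def
      by (rule fat_ideal_mult) (use assms(6) in \<open>auto simp: fattening_def\<close>)
    show "partial_deriv i F \<in> I0" if "F \<in> I1" for F i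
      using that unfolding I0_eq I1_eq by (rule partial_deriv_fat_ideal)
    show "partial_deriv i F \<in> I1" if "F \<in> I2" for F i
      using that unfolding I2_eq I1_eq by (rule partial_deriv_fat_ideal)
    show "F \<in> I2" if "F \<in> I1" "\<And>i. partial_deriv i F \<in> I1" for F
      unfolding I2_eq
    \<comment> \<open>The exponents at this step are m_j + 1, hence nonzero, and the least index is
      the variable X_0, which vanishes at none of the points.\<close>
    proof (rule fat_ideal_fattening_criterion[where z = ?z])
      show "F \<in> fat_ideal s P (fattening m 1)" "partial_deriv i F \<in> fat_ideal s P (fattening m 1)" for i
        using that unfolding I1_eq by auto
    qed (use assms(4) in \<open>auto simp: fattening_def\<close>)
  qed
  have I0: "homog_ideal I0" and I1: "homog_ideal I1"
    by (simp_all add: C.h0 C.h1)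
  \<comment> \<open>The submodules of the statement are given as ideal products; they agree with the
    coefficientwise ones for which the complex was built.\<close>
  have N2: "N2 = C.N2" and N3: "N3 = C.N3" and U2: "ideal_times S Omega1 I0 = pointwise UNIV I0"
    by (simp_all add: N2_def N3_def S_def C.N2_def C.N3_def Omega1_eq Omega2_eq ideal_times_forms I0 I1)
  have M1: "M1 = C.S1.Q" and G1: "G1 = C.S1.QG"
    by (simp_all add: M1_def G1_def S_def)
  have M2: "M2 = C.S2.Q" and G2: "G2 = C.S2.QG"
    by (simp_all add: M2_def G2_def N2 U2[unfolded Omega1_eq] Omega1_eq form1_part_eq)
  have M3: "M3 = C.S3.Q" and G3: "G3 = C.S3.QG"
    by (simp_all add: M3_def G3_def N3 Omega2_eq form2_part_eq)
  have M4: "M4 = C.S4.Q" and G4: "G4 = C.S4.QG"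
    by (simp_all add: M4_def G4_def Kaehler2_def Kaehler2_part_def Omega2_eq form2_part_eq)
  have alpha: "\<forall>F\<in>I1. C.\<alpha>.fbar (I2 +>\<^bsub>S\<^esub> F) = N2 +>\<^bsub>Omega1\<^esub> d0 F"
    by (simp add: S_def N2 Omega1_eq C.\<alpha>.fbar_coset flip: coset_regular)
  have beta: "\<forall>G\<in>I0. \<forall>i. C.\<beta>.fbar (N2 +>\<^bsub>Omega1\<^esub> (G \<odot>\<^bsub>Omega1\<^esub> dX i)) = N3 +>\<^bsub>Omega2\<^esub> d1 (G \<odot>\<^bsub>Omega1\<^esub> dX i)"
  proof (intro ballI allI)
    fix G i assume "G \<in> I0"
    then have "G \<odot>\<^bsub>forms UNIV\<^esub> dX i \<in> pointwise UNIV I0"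
      by (auto simp: pointwise_def smult_forms intro: ideal_mult_right[OF C.ideals(1)])
    then show "C.\<beta>.fbar (N2 +>\<^bsub>Omega1\<^esub> (G \<odot>\<^bsub>Omega1\<^esub> dX i)) = N3 +>\<^bsub>Omega2\<^esub> d1 (G \<odot>\<^bsub>Omega1\<^esub> dX i)"
      by (simp add: N2 N3 Omega1_eq Omega2_eq C.\<beta>.fbar_coset)
  qed
  have gamma: "\<forall>H\<in>carrier Omega2. C.\<gamma>.fbar (N3 +>\<^bsub>Omega2\<^esub> H) = kaehler2_relations I0 +>\<^bsub>Omega2\<^esub> H"
    by (simp add: N3 Omega2_eq C.\<gamma>.fbar_coset)
  show ?thesis
    unfolding M1 M2 M3 M4 G1 G2 G3 G4 R_def RG_def
    using C.S1.graded_module_Q C.S2.graded_module_Q C.S3.graded_module_Q C.S4.graded_module_Q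
      C.\<alpha>.graded_hom_fbar C.\<beta>.graded_hom_fbar C.\<gamma>.graded_hom_fbar alpha beta gamma
      C.beta_alpha C.gamma_beta C.inj_alpha C.surj_gamma C.ker_gamma C.hilbert_bound[OF assms(1)]
    by (intro conjI exI[of _ C.\<alpha>.fbar] exI[of _ C.\<beta>.fbar] exI[of _ C.\<gamma>.fbar]) auto
qed

end
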